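(* Let $A \subseteq \mathbb{N}$ with $d(A) > 0$, and let $\mathbf{N} = (N_s)_{s \in \mathbb{N}}$ and $\mathbf{H}=(H_s)_{s\in\mathbb{N}}$ be sequences in $\mathbb{N}$ with $1\prec \mathbf{H}\prec \mathbf{N}$ and $\lim_{s\to\infty} N_s/N_{s+1}=0$. If $(\mathbf{N},\mathbf{H})$ is a $U^2$ good scale for $1_A$, then there exist sequences $\epsilon_s \to 0$ and $\delta_s \to 0$ such that for all but $o(N_s)$ many $n\in \{N_{s-1}+1,\ldots,N_s\}$ there exists $Q_n\in\mathbb{N}$ with $H_s\leq Q_n\leq (1+\epsilon_s)H_s$, with $\lim_{n \to \infty} \min\{m \in \mathbb{N} : m \nmid Q_n\} = \infty$, such that for every $\tilde{B}_s \subseteq [H_s]$, \[ \Big| \Big( \big( (A-n)\cap \{0,1,\ldots,Q_n-1\} \big) +_{\delta_s,\bmod{Q_n}} \tilde{B}_s \Big) \setminus \Big( (A+\tilde{B}_s-n)\cap\{0,1,\ldots,Q_n-1\} \Big) \Big| \leq \epsilon_s Q_n. \]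
   Context: $N_0=0$, $[L]=\{1,\dots,L\}$, $d(A)=\lim_N|A\cap[N]|/N$, $A-n=\{a-n:a\in A\}$. For $E,F$ viewed as subsets of $\mathbb{Z}/Q\mathbb{Z}$ (reducing mod $Q$), $E+_{\delta,\bmod Q}F=\{x\in\{0,\dots,Q-1\}:|\{(e,f)\in E\times F: e+f\equiv x \bmod Q\}|>\delta Q\}$. Sequence order: $1\prec\mathbf{H}$ means $H_s\to\infty$; $\mathbf{H}\prec\mathbf{N}$ means $H_s/N_s\to0$. $e(x)=e^{2\pi ix}$, $\|x\|_{\mathbb{T}}$ = distance to nearest integer, $\mathbb{E}_{n\in\mathbf{N}}a(n)=\lim_s\frac1{N_s}\sum_{n=1}^{N_s}a(n)$, $\|g\|_{2,\mathbf{N}}=(\mathbb{E}_{n\in\mathbf{N}}|g|^2)^{1/2}$. Gowers norm: $\|u\|^4_{U^2(\mathbb{Z}/M\mathbb{Z})}=M^{-3}\sum_{x,h_1,h_2}u(x)\overline{u(x+h_1)u(x+h_2)}u(x+h_1+h_2)$; $\|g\|_{U^2(\{x+1,\dots,x+L\})}=\|\tilde g\|_{U^2(\mathbb{Z}/M\mathbb{Z})}/\|1_{[L]}\|_{U^2(\mathbb{Z}/M\mathbb{Z})}$ with $M\ge4L$, $\tilde g(n)=1_{[L]}(n)g(x+n)$; $\|g\|_{U^2(\mathbf{N},\mathbf{H})}=\lim_s\frac1{N_s-H_s+1}\sum_{n=1}^{N_s-H_s+1}\|g\|_{U^2(\{n,\dots,n+H_s-1\})}$. $(\mathbf{N},\mathbf{H})$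 is a $U^2$ good scale for $f\colon\mathbb{N}\to[0,1]$ if $f=f_{\mathrm{str}}+f_{\mathrm{unf}}$ with: (i) $f_{\mathrm{str}}\in[0,1]$, $\mathbb{E}_{n\in\mathbf{N}}f_{\mathrm{unf}}=0$; (ii) for every $\epsilon>0$ there are $d$, $c_i\colon\mathbb{N}\to\mathbb{C}$ with $\|c_i\|_\infty\le1$ and $\alpha_i\colon\mathbb{N}\to\mathbb{R}$ ($i\le d$) with $\|\sum_ic_i(n)e(n\alpha_i(n))-f_{\mathrm{str}}\|_{2,\mathbf{N}}\le\epsilon$, such that for every $C\ge1$ the sets of $n\in[N_s-H_s+1]$ on which all $\alpha_i(n+\cdot)$ are constant on $[H_s]$, on which all $c_i(n+\cdot)$ are constant on $[H_s]$, and on which every $w\in[-C,C]^d\cap\mathbb{Z}^d$ has $\|\sum w_i\alpha_i(n)\|_{\mathbb{T}}\le\frac1{CH_s}$ or $\ge\frac{C}{H_s}$, each have size $(1-o(1))(N_s-H_s+1)$; (iii) some $\mathbf{H}'$ with $1\prec\mathbf{H}'\prec\mathbf{H}$ has $\|f_{\mathrm{unf}}\|_{U^2(\mathbf{N},\mathbf{H}')}=0$. *)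

theory Defs
  imports "HOL-Analysis.Analysis" "HOL-Library.Set_Algebras"
begin

text \<open>
  The natural numbers of the source start at 1. Functions on them are rendered as functions on
  \<^typ>\<open>nat\<close> whose value at 0 is never used, and a sequence indexed by them as a function on
  \<^typ>\<open>nat\<close> whose value at 0 is either irrelevant or fixed by convention.
  A quantity that is defined as a limit is rendered as a relation to its value, so that asserting
  something about the value includes the existence of the limit.
\<close>

definition has_density :: "nat set \<Rightarrow> real \<Rightarrow> bool" where
  "has_density A d \<longleftrightarrow> (\<lambda>N. real (card (A \<inter> {1..N})) / real N) \<longlonglongrightarrow> d"

definition shift :: "nat set \<Rightarrow> nat \<Rightarrow> int set" where
  "shift A n = (\<lambda>a. int a - int n) ` A"

definition popular_sumset :: "real \<Rightarrow> nat \<Rightarrow> int set \<Rightarrow> int set \<Rightarrow> int set" where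
  "popular_sumset \<delta> Q E F =
     {x \<in> {0..<int Q}.
        real (card {(e, f) \<in> ((\<lambda>a. a mod int Q) ` E) \<times> ((\<lambda>a. a mod int Q) ` F).
                      (e + f) mod int Q = x mod int Q}) > \<delta> * real Q}"

definition seq_prec :: "(nat \<Rightarrow> nat) \<Rightarrow> (nat \<Rightarrow> nat) \<Rightarrow> bool" (infix "\<prec>" 50) where
  "H \<prec> N \<longleftrightarrow> (\<lambda>s. real (H s) / real (N s)) \<longlonglongrightarrow> 0"

definition e_circ :: "real \<Rightarrow> complex" where
  "e_circ x = exp (2 * of_real pi * \<i> * of_real x)"

definition norm_T :: "real \<Rightarrow> real" where
  "norm_T x = infdist x \<int>"

definition has_avg :: "(nat \<Rightarrow> nat) \<Rightarrow> (nat \<Rightarrow> real) \<Rightarrow> real \<Rightarrow> bool" where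
  "has_avg N a l \<longleftrightarrow> (\<lambda>s. (\<Sum>n=1..N s. a n) / real (N s)) \<longlonglongrightarrow> l"

definition has_L2_norm :: "(nat \<Rightarrow> nat) \<Rightarrow> (nat \<Rightarrow> complex) \<Rightarrow> real \<Rightarrow> bool" where
  "has_L2_norm N g r \<longleftrightarrow> (\<exists>l. has_avg N (\<lambda>n. (cmod (g n))\<^sup>2) l \<and> r = sqrt l)"

text \<open>
  Functions on the integers modulo \<open>M\<close> are given by their values on \<open>{0..<M}\<close>.
  The sum is always real and nonnegative.
\<close>

definition U2_cyclic :: "nat \<Rightarrow> (nat \<Rightarrow> complex) \<Rightarrow> real" where
  "U2_cyclic M u =
     root 4 (Re ((\<Sum>x<M. \<Sum>h1<M. \<Sum>h2<M.
        u x * cnj (u ((x + h1) mod M) * u ((x + h2) mod M)) * u ((x + h1 + h2) mod M))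
        / of_nat (M ^ 3)))"

text \<open>
  Norm on \<open>{x+1..x+L}\<close>. The quotient is the same for every modulus \<open>M \<ge> 4 * L\<close>
  (a function supported on \<open>{1..L}\<close> sees no wrap-around), so \<open>M = 4 * L\<close> is taken.
\<close>

definition U2_interval :: "nat \<Rightarrow> nat \<Rightarrow> (nat \<Rightarrow> complex) \<Rightarrow> real" where
  "U2_interval x L g =
     U2_cyclic (4 * L) (\<lambda>n. indicator {1..L} n * g (x + n)) /
     U2_cyclic (4 * L) (indicator {1..L})"

definition has_U2_norm ::
  "(nat \<Rightarrow> nat) \<Rightarrow> (nat \<Rightarrow> nat) \<Rightarrow> (nat \<Rightarrow> complex) \<Rightarrow> real \<Rightarrow> bool" where
  "has_U2_norm N H g l \<longleftrightarrow>
     (\<lambda>s. (\<Sum>n=1..N s + 1 - H s. U2_interval (n - 1) (H s) g) / real (N s + 1 - H s))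
       \<longlonglongrightarrow> l"

text \<open>The set of \<open>n\<close> satisfying \<open>P s n\<close> has size \<open>(1 - o(1)) (N s - H s + 1)\<close>.\<close>

definition for_most_windows ::
  "(nat \<Rightarrow> nat) \<Rightarrow> (nat \<Rightarrow> nat) \<Rightarrow> (nat \<Rightarrow> nat \<Rightarrow> bool) \<Rightarrow> bool" where
  "for_most_windows N H P \<longleftrightarrow>
     (\<lambda>s. real (card {n \<in> {1..N s + 1 - H s}. P s n}) / real (N s + 1 - H s)) \<longlonglongrightarrow> 1"

definition U2_structured ::
  "(nat \<Rightarrow> nat) \<Rightarrow> (nat \<Rightarrow> nat) \<Rightarrow> (nat \<Rightarrow> real) \<Rightarrow> bool" where
  "U2_structured N H f \<longleftrightarrow>
     (\<forall>\<epsilon>>0. \<exists>(d::nat) (c :: nat \<Rightarrow> nat \<Rightarrow> complex) (\<alpha> :: nat \<Rightarrow> nat \<Rightarrow> real).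
        (\<forall>i\<in>{1..d}. \<forall>n\<ge>1. cmod (c i n) \<le> 1) \<and>
        (\<exists>r\<le>\<epsilon>. has_L2_norm N
           (\<lambda>n. (\<Sum>i=1..d. c i n * e_circ (real n * \<alpha> i n)) - of_real (f n)) r) \<and>
        (\<forall>C::real. C \<ge> 1 \<longrightarrow>
           for_most_windows N H
             (\<lambda>s n. \<forall>i\<in>{1..d}. (\<lambda>h. \<alpha> i (n + h)) constant_on {1..H s}) \<and>
           for_most_windows N H
             (\<lambda>s n. \<forall>i\<in>{1..d}. (\<lambda>h. c i (n + h)) constant_on {1..H s}) \<and>
           for_most_windows N H
             (\<lambda>s n. \<forall>w :: nat \<Rightarrow> int. (\<forall>i\<in>{1..d}. \<bar>real_of_int (w i)\<bar> \<le> C) \<longrightarrow>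
                norm_T (\<Sum>i=1..d. real_of_int (w i) * \<alpha> i n) \<le> 1 / (C * real (H s)) \<or>
                norm_T (\<Sum>i=1..d. real_of_int (w i) * \<alpha> i n) \<ge> C / real (H s))))"

definition U2_good_scale ::
  "(nat \<Rightarrow> nat) \<Rightarrow> (nat \<Rightarrow> nat) \<Rightarrow> (nat \<Rightarrow> real) \<Rightarrow> bool" where
  "U2_good_scale N H f \<longleftrightarrow>
     (\<exists>f\<^sub>s\<^sub>t\<^sub>r f\<^sub>u\<^sub>n\<^sub>f :: nat \<Rightarrow> real.
        (\<forall>n\<ge>1. f n = f\<^sub>s\<^sub>t\<^sub>r n + f\<^sub>u\<^sub>n\<^sub>f n) \<and>
        (\<forall>n\<ge>1. f\<^sub>s\<^sub>t\<^sub>r n \<in> {0..1}) \<and>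
        has_avg N f\<^sub>u\<^sub>n\<^sub>f 0 \<and>
        U2_structured N H f\<^sub>s\<^sub>t\<^sub>r \<and>
        (\<exists>H'. (\<forall>s\<ge>1. H' s \<ge> 1) \<and> filterlim H' at_top sequentially \<and> H' \<prec> H \<and>
              has_U2_norm N H' (\<lambda>n. of_real (f\<^sub>u\<^sub>n\<^sub>f n)) 0))"

definition least_nondivisor :: "nat \<Rightarrow> nat" where
  "least_nondivisor q = (LEAST m. m \<ge> 1 \<and> \<not> m dvd q)"

end

theory Submission
  imports Defs
begin

text \<open>
  Let \<open>S\<close> be the set of popular sums that are not sums. For \<open>x \<in> S\<close> no \<open>b \<in> B\<close> has \<open>n + x - b \<in> A\<close>, so
  all of its more than \<open>\<delta> Q\<close> representations modulo \<open>Q\<close> wrap around: \<open>n + x - b + Q \<in> A\<close> with \<open>b > x\<close>.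
  Hence \<open>\<delta> Q |S|\<close> is at most the sum of \<open>1\<^sub>A(n + x - b + Q) - 1\<^sub>A(n + x - b)\<close> over \<open>x \<in> S\<close>,
  \<open>b \<in> B\<close> with \<open>b > x\<close>. Splitting \<open>1\<^sub>A\<close> into its two parts, the structured part contributes little
  because \<open>Q\<close> is chosen to be an almost period of all frequencies on the window, and the uniform part
  contributes little because such a bilinear sum, cut into pieces of length \<open>H'\<close>, is controlled by the
  local \<open>U\<^sup>2\<close> norms via two applications of the Cauchy-Schwarz inequality.

  An almost period \<open>Q \<in> [H, (1 + \<epsilon>) H]\<close> divisible by a prescribed \<open>W\<close> exists by averaging the
  product of the weights \<open>((1 + cos (2 \<pi> Q \<alpha>\<^sub>i)) / 2)\<^sup>k\<close> over the multiples of \<open>W\<close> in that interval. All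
  Fourier coefficients of this product are nonnegative, and by the gap condition every frequency
  that occurs is either so small that it contributes nonnegatively, or so large that it cancels.
  A diagonal argument over the tolerance \<open>1 / K\<close> and the divisor \<open>K!\<close> then yields the theorem.
\<close>

subsection \<open>Bilinear sums and the \<open>U\<^sup>2\<close> norm\<close>

lemma sum_lessThan_mod_shift:
  fixes f :: "nat \<Rightarrow> real"
  shows "(\<Sum>x<M. f ((x + c) mod M)) = (\<Sum>x<M. f x)"
proof (cases "M = 0")
  case False
  have inj: "inj_on (\<lambda>x. (x + c) mod M) {..<M}"
  proof (rule linorder_inj_onI)
    fix x y assume xy: "x < y" "x \<in> {..<M}" "y \<in> {..<M}"
    show "(x + c) mod M \<noteq> (y + c) mod M"
    proof
      assume "(x + c) mod M = (y + c) mod M"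
      then have "M dvd (y + c) - (x + c)"
        using xy mod_eq_dvd_iff_nat[of "x + c" "y + c" M] by simp
      then show False using xy by (auto dest: dvd_imp_le)
    qed
  qed auto
  have "(\<lambda>x. (x + c) mod M) ` {..<M} = {..<M}"
    by (rule endo_inj_surj[OF _ _ inj]) (use False in auto)
  then show ?thesis
    by (metis (no_types, lifting) inj sum.reindex_cong)
qed simp

definition autocorr :: "nat \<Rightarrow> (nat \<Rightarrow> real) \<Rightarrow> nat \<Rightarrow> real" where
  "autocorr M w h = (\<Sum>x<M. w x * w ((x + h) mod M))"

text \<open>For fixed \<open>h1\<close> the sum over \<open>h2\<close> of the two shifted factors is
  invariant under translation by \<open>x\<close>, so it equals \<open>autocorr M w h1\<close>; the
  remaining sum over \<open>x\<close> is the same quantity, and the triple sum collapses to a sum of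
  squares.\<close>

lemma U2_cyclic_of_real:
  "U2_cyclic M (\<lambda>n. of_real (w n)) = root 4 ((\<Sum>h<M. (autocorr M w h)\<^sup>2) / real M ^ 3)"
proof -
  have "(\<Sum>x<M. \<Sum>h1<M. \<Sum>h2<M.
      w x * (w ((x + h1) mod M) * w ((x + h2) mod M)) * w ((x + h1 + h2) mod M))
    = (\<Sum>h1<M. \<Sum>x<M. \<Sum>h2<M.
      w x * (w ((x + h1) mod M) * w ((x + h2) mod M)) * w ((x + h1 + h2) mod M))"
    by (rule sum.swap)
  also have "\<dots> = (\<Sum>h1<M. \<Sum>x<M. w x * w ((x + h1) mod M) * autocorr M w h1)"
  proof (intro sum.cong refl)
    fix h x
    have "(\<Sum>z<M. w ((z + x) mod M) * w (((z + x) mod M + h) mod M)) = autocorr M w h"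
      unfolding autocorr_def by (rule sum_lessThan_mod_shift)
    then show "(\<Sum>h2<M. w x * (w ((x + h) mod M) * w ((x + h2) mod M)) * w ((x + h + h2) mod M))
      = w x * w ((x + h) mod M) * autocorr M w h"
      by (simp add: mod_add_left_eq mod_add_right_eq add_ac mult_ac sum_distrib_left flip: \<open>_ = autocorr M w h\<close>)
  qed
  also have "\<dots> = (\<Sum>h<M. (autocorr M w h)\<^sup>2)"
    by (simp add: autocorr_def power2_eq_square flip: sum_distrib_right)
  finally have real: "(\<Sum>x<M. \<Sum>h1<M. \<Sum>h2<M.
      w x * (w ((x + h1) mod M) * w ((x + h2) mod M)) * w ((x + h1 + h2) mod M))
    = (\<Sum>h<M. (autocorr M w h)\<^sup>2)" .
  have "(\<Sum>x<M. \<Sum>h1<M. \<Sum>h2<M. complex_of_real (w x) *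
      cnj (complex_of_real (w ((x + h1) mod M)) * complex_of_real (w ((x + h2) mod M))) *
      complex_of_real (w ((x + h1 + h2) mod M)))
    = complex_of_real (\<Sum>h<M. (autocorr M w h)\<^sup>2)"
    unfolding real[symmetric] by simp
  then show ?thesis
    unfolding U2_cyclic_def by (simp only: Re_divide_of_nat Re_complex_of_real) simp
qed

text \<open>The first Cauchy-Schwarz step removes \<open>p\<close>. The square sum of what remains
  is the correlation of the autocorrelations of \<open>w\<close> and \<open>q\<close>; a second
  application separates these two, and \<open>autocorr M q h\<close> is bounded uniformly in
  \<open>h\<close> by the square sum of \<open>q\<close>.\<close>

lemma cyclic_bilinear_power4_le:
  fixes p q w :: "nat \<Rightarrow> real"
  shows "(\<Sum>x<M. \<Sum>z<M. p x * q ((x + z) mod M) * w z) ^ 4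
    \<le> (\<Sum>x<M. (p x)\<^sup>2)\<^sup>2 * (\<Sum>x<M. (q x)\<^sup>2)\<^sup>2 * real M * (\<Sum>h<M. (autocorr M w h)\<^sup>2)"
proof -
  define F where "F x = (\<Sum>z<M. q ((x + z) mod M) * w z)" for x
  define P where "P = (\<Sum>x<M. (p x)\<^sup>2)"
  define R where "R = (\<Sum>x<M. (q x)\<^sup>2)"
  have F2: "(\<Sum>x<M. (F x)\<^sup>2) = (\<Sum>h<M. autocorr M w h * autocorr M q h)"
  proof -
    \<comment> \<open>Starting the cyclic sum at \<open>z\<close> makes \<open>h\<close> the
      difference of the two variables when \<open>F x\<close> is squared.\<close>
    have Fs: "F x = (\<Sum>h<M. q ((x + z + h) mod M) * w ((z + h) mod M))" for x z
    proof -
      have "(\<Sum>h<M. q ((x + ((h + z) mod M)) mod M) * w ((h + z) mod M)) = F x"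
        unfolding F_def by (rule sum_lessThan_mod_shift)
      then show ?thesis by (simp add: mod_add_right_eq add_ac)
    qed
    have "(\<Sum>x<M. (F x)\<^sup>2) = (\<Sum>x<M. \<Sum>z<M. q ((x + z) mod M) * w z * F x)"
      by (simp add: power2_eq_square sum_distrib_right F_def)
    also have "\<dots> = (\<Sum>x<M. \<Sum>z<M. \<Sum>h<M.
        (w z * w ((z + h) mod M)) * (q ((x + z) mod M) * q ((x + z + h) mod M)))"
      by (intro sum.cong refl, subst Fs) (simp add: sum_distrib_left mult_ac)
    also have "\<dots> = (\<Sum>z<M. \<Sum>x<M. \<Sum>h<M.
        (w z * w ((z + h) mod M)) * (q ((x + z) mod M) * q ((x + z + h) mod M)))"
      by (rule sum.swap)
    also have "\<dots> = (\<Sum>z<M. \<Sum>h<M. \<Sum>x<M.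
        (w z * w ((z + h) mod M)) * (q ((x + z) mod M) * q ((x + z + h) mod M)))"
      by (intro sum.cong refl sum.swap)
    also have "\<dots> = (\<Sum>z<M. \<Sum>h<M. (w z * w ((z + h) mod M)) * autocorr M q h)"
    proof (intro sum.cong refl)
      fix z h
      have "(\<Sum>x<M. q ((x + z) mod M) * q (((x + z) mod M + h) mod M)) = autocorr M q h"
        unfolding autocorr_def by (rule sum_lessThan_mod_shift)
      then show "(\<Sum>x<M. (w z * w ((z + h) mod M)) * (q ((x + z) mod M) * q ((x + z + h) mod M)))
        = (w z * w ((z + h) mod M)) * autocorr M q h"
        by (simp add: mod_add_left_eq flip: sum_distrib_left)
    qed
    also have "\<dots> = (\<Sum>h<M. \<Sum>z<M. (w z * w ((z + h) mod M)) * autocorr M q h)"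
      by (rule sum.swap)
    also have "\<dots> = (\<Sum>h<M. autocorr M w h * autocorr M q h)"
      by (simp add: autocorr_def sum_distrib_right)
    finally show ?thesis .
  qed
  have qh: "(autocorr M q h)\<^sup>2 \<le> R\<^sup>2" for h
  proof -
    have "(autocorr M q h)\<^sup>2 \<le> R * (\<Sum>x<M. (q ((x + h) mod M))\<^sup>2)"
      unfolding autocorr_def R_def by (rule Cauchy_Schwarz_ineq_sum)
    also have "(\<Sum>x<M. (q ((x + h) mod M))\<^sup>2) = R"
      unfolding R_def by (rule sum_lessThan_mod_shift)
    finally show ?thesis by (simp add: power2_eq_square)
  qed
  have "(\<Sum>x<M. \<Sum>z<M. p x * q ((x + z) mod M) * w z) = (\<Sum>x<M. p x * F x)"
    by (simp add: F_def sum_distrib_left mult_ac)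
  then have "(\<Sum>x<M. \<Sum>z<M. p x * q ((x + z) mod M) * w z) ^ 4 = ((\<Sum>x<M. p x * F x)\<^sup>2)\<^sup>2"
    by simp
  also have "\<dots> \<le> (P * (\<Sum>x<M. (F x)\<^sup>2))\<^sup>2"
    unfolding P_def by (intro power_mono Cauchy_Schwarz_ineq_sum) simp
  also have "\<dots> = P\<^sup>2 * (\<Sum>h<M. autocorr M w h * autocorr M q h)\<^sup>2"
    by (simp add: F2 power_mult_distrib)
  also have "\<dots> \<le> P\<^sup>2 * ((\<Sum>h<M. (autocorr M w h)\<^sup>2) * (\<Sum>h<M. (autocorr M q h)\<^sup>2))"
    by (intro mult_left_mono Cauchy_Schwarz_ineq_sum) simp
  also have "\<dots> \<le> P\<^sup>2 * ((\<Sum>h<M. (autocorr M w h)\<^sup>2) * (\<Sum>h<M. R\<^sup>2))"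
    by (intro mult_left_mono sum_mono qh) (auto intro: sum_nonneg)
  finally show ?thesis
    by (simp add: P_def R_def mult_ac)
qed

text \<open>This concerns the normalising factor of \<open>U2_interval\<close>: positivity makes the
  quotient meaningful, and the bound by 1 lets \<open>U2_cyclic\<close> be replaced by the larger
  \<open>U2_interval\<close>.\<close>

lemma U2_cyclic_indicator_bounds:
  assumes "L \<ge> 1"
  shows "0 < U2_cyclic (4 * L) (indicator {1..L})" and "U2_cyclic (4 * L) (indicator {1..L}) \<le> 1"
proof -
  define w :: "nat \<Rightarrow> real" where "w = indicator {1..L}"
  define M where "M = 4 * L"
  have M: "M > 0" using assms by (simp add: M_def)
  have w01: "0 \<le> w x" "w x \<le> 1" for x by (auto simp: w_def indicator_def)
  have eq: "U2_cyclic (4 * L) (indicator {1..L}) = root 4 ((\<Sum>h<M. (autocorr M w h)\<^sup>2) / real M ^ 3)"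
  proof -
    have "(indicator {1..L} :: nat \<Rightarrow> complex) = (\<lambda>n. of_real (w n))"
      by (auto simp: w_def indicator_def)
    then show ?thesis by (simp only: U2_cyclic_of_real M_def)
  qed
  have le: "autocorr M w h \<le> real M" "0 \<le> autocorr M w h" for h
  proof -
    have "autocorr M w h \<le> (\<Sum>x<M. 1)"
      unfolding autocorr_def by (intro sum_mono mult_le_one w01)
    then show "autocorr M w h \<le> real M" by simp
    show "0 \<le> autocorr M w h"
      unfolding autocorr_def by (intro sum_nonneg mult_nonneg_nonneg w01)
  qed
  have "(\<Sum>h<M. (autocorr M w h)\<^sup>2) \<le> (\<Sum>h<M. (real M)\<^sup>2)"
    by (intro sum_mono power_mono le)
  then have "(\<Sum>h<M. (autocorr M w h)\<^sup>2) / real M ^ 3 \<le> 1"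
    using M by (simp add: divide_simps power2_eq_square power3_eq_cube mult_ac)
  then show "U2_cyclic (4 * L) (indicator {1..L}) \<le> 1"
    unfolding eq by simp
  \<comment> \<open>The diagonal term \<open>x = 1\<close>, \<open>h = 0\<close> alone makes the sum
    positive.\<close>
  have "0 < w 1 * w ((1 + 0) mod M)" using assms by (simp add: w_def M_def)
  also have "\<dots> \<le> autocorr M w 0"
    unfolding autocorr_def
    by (rule member_le_sum[where f = "\<lambda>x. w x * w ((x + 0) mod M)"]) (use w01 assms in \<open>auto simp: M_def\<close>)
  finally have "0 < (autocorr M w 0)\<^sup>2" by simp
  also have "\<dots> \<le> (\<Sum>h<M. (autocorr M w h)\<^sup>2)"
    by (rule member_le_sum) (use M in auto)
  finally show "0 < U2_cyclic (4 * L) (indicator {1..L})"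
    unfolding eq using M by simp
qed

lemma U2_interval_nonneg: "0 \<le> U2_interval x L (\<lambda>n. of_real (f n))"
proof (cases "L \<ge> 1")
  case True
  have "(\<lambda>n. indicator {1..L} n * complex_of_real (f (x + n)))
     = (\<lambda>n. of_real (indicator {1..L} n * f (x + n)))"
    by (auto simp: indicator_def)
  then have "0 \<le> U2_cyclic (4 * L) (\<lambda>n. indicator {1..L} n * complex_of_real (f (x + n)))"
    by (simp only: U2_cyclic_of_real) (intro real_root_ge_zero divide_nonneg_nonneg sum_nonneg; simp)
  then show ?thesis
    unfolding U2_interval_def using U2_cyclic_indicator_bounds[OF True] by simp
\<comment> \<open>For \<open>L = 0\<close> the modulus is 0, all sums are empty and the quotient is
  0.\<close>
qed (simp add: U2_interval_def U2_cyclic_def)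

text \<open>The three functions are cut off to \<open>{..<L}\<close>, \<open>{..<2 * L}\<close> and
  \<open>{1..L}\<close> and placed on the integers modulo \<open>4 * L\<close>. Since
  \<open>x + z < 2 * L\<close> on the supports, nothing wraps around and the cyclic bound applies to
  the same sum.\<close>

lemma bilinear_le_U2_interval:
  fixes p q f :: "nat \<Rightarrow> real"
  assumes L: "L \<ge> 1" and p: "\<And>x. \<bar>p x\<bar> \<le> 1" and q: "\<And>x. \<bar>q x\<bar> \<le> 1"
  shows "\<bar>\<Sum>x<L. \<Sum>z=1..L. p x * q (x + z) * f (m + z)\<bar>
     \<le> 6 * (real L)\<^sup>2 * U2_interval m L (\<lambda>n. of_real (f n))"
proof -
  define M where "M = 4 * L"
  define p' where "p' x = (if x < L then p x else 0)" for x
  define q' where "q' x = (if x < 2 * L then q x else 0)" for x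
  define w where "w z = indicator {1..L} z * f (m + z)" for z
  define S where "S = (\<Sum>x<L. \<Sum>z=1..L. p x * q (x + z) * f (m + z))"
  define U where "U = U2_cyclic M (\<lambda>n. of_real (w n))"
  have Ueq: "U2_interval m L (\<lambda>n. of_real (f n)) = U / U2_cyclic (4 * L) (indicator {1..L})"
  proof -
    have "(\<lambda>n. indicator {1..L} n * complex_of_real (f (m + n))) = (\<lambda>n. of_real (w n))"
      by (auto simp: indicator_def w_def)
    then show ?thesis by (simp add: U2_interval_def U_def M_def)
  qed
  have U4: "U ^ 4 = (\<Sum>h<M. (autocorr M w h)\<^sup>2) / real M ^ 3" and U0: "0 \<le> U"
  proof -
    have "0 \<le> (\<Sum>h<M. (autocorr M w h)\<^sup>2) / real M ^ 3"
      by (intro divide_nonneg_nonneg sum_nonneg; simp)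
    then show "U ^ 4 = (\<Sum>h<M. (autocorr M w h)\<^sup>2) / real M ^ 3" "0 \<le> U"
      by (auto simp: U_def U2_cyclic_of_real)
  qed
  have "(\<Sum>x<M. \<Sum>z<M. p' x * q' ((x + z) mod M) * w z) =
        (\<Sum>x<L. \<Sum>z<M. p' x * q' ((x + z) mod M) * w z)"
    by (rule sum.mono_neutral_right) (auto simp: p'_def M_def)
  also have "\<dots> = (\<Sum>x<L. \<Sum>z=1..L. p' x * q' ((x + z) mod M) * w z)"
    by (intro sum.cong refl sum.mono_neutral_right) (use L in \<open>auto simp: w_def M_def\<close>)
  also have "\<dots> = S"
    unfolding S_def by (intro sum.cong refl) (auto simp: p'_def q'_def w_def M_def)
  finally have S: "S = (\<Sum>x<M. \<Sum>z<M. p' x * q' ((x + z) mod M) * w z)" by simp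
  have P: "(\<Sum>x<M. (p' x)\<^sup>2) \<le> real L"
  proof -
    have "(\<Sum>x<M. (p' x)\<^sup>2) \<le> (\<Sum>x<M. if x \<in> {..<L} then 1 else 0)"
      by (intro sum_mono) (auto simp: p'_def p abs_square_le_1)
    also have "\<dots> = real (card ({..<M} \<inter> {..<L}))"
      by (subst sum.inter_restrict[symmetric]) auto
    also have "{..<M} \<inter> {..<L} = {..<L}" by (auto simp: M_def)
    finally show ?thesis by simp
  qed
  have R: "(\<Sum>x<M. (q' x)\<^sup>2) \<le> 2 * real L"
  proof -
    have "(\<Sum>x<M. (q' x)\<^sup>2) \<le> (\<Sum>x<M. if x \<in> {..<2*L} then 1 else 0)"
      by (intro sum_mono) (auto simp: q'_def q abs_square_le_1)
    also have "\<dots> = real (card ({..<M} \<inter> {..<2*L}))"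
      by (subst sum.inter_restrict[symmetric]) auto
    also have "{..<M} \<inter> {..<2*L} = {..<2*L}" by (auto simp: M_def)
    finally show ?thesis by simp
  qed
  have "S ^ 4 \<le> (\<Sum>x<M. (p' x)\<^sup>2)\<^sup>2 * (\<Sum>x<M. (q' x)\<^sup>2)\<^sup>2 * real M * (\<Sum>h<M. (autocorr M w h)\<^sup>2)"
    unfolding S by (rule cyclic_bilinear_power4_le)
  also have "\<dots> \<le> (real L)\<^sup>2 * (2 * real L)\<^sup>2 * real M * (\<Sum>h<M. (autocorr M w h)\<^sup>2)"
    by (intro mult_right_mono mult_mono power_mono P R) (auto intro!: sum_nonneg)
  also have "(\<Sum>h<M. (autocorr M w h)\<^sup>2) = real M ^ 3 * U ^ 4"
    using L by (simp add: U4 M_def)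
  also have "(real L)\<^sup>2 * (2 * real L)\<^sup>2 * real M * (real M ^ 3 * U ^ 4) = 1024 * (real L ^ 8 * U ^ 4)"
    by (simp add: M_def power_mult_distrib) (simp add: power2_eq_square power3_eq_cube eval_nat_numeral)
  \<comment> \<open>\<open>6 ^ 4 = 1296\<close> is the least fourth power of an integer above
    1024.\<close>
  also have "\<dots> \<le> 6 ^ 4 * (real L ^ 8 * U ^ 4)"
    by (intro mult_right_mono) auto
  also have "\<dots> = (6 * (real L)\<^sup>2 * U) ^ 4"
    by (simp add: power_mult_distrib flip: power_mult)
  finally have "\<bar>S\<bar> ^ 4 \<le> (6 * (real L)\<^sup>2 * U) ^ 4"
    by simp
  then have "\<bar>S\<bar> \<le> 6 * (real L)\<^sup>2 * U"
    by (rule power_mono_iff[THEN iffD1, rotated 3]) (use U0 in auto)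
  also have "U \<le> U2_interval m L (\<lambda>n. of_real (f n))"
    unfolding Ueq using U2_cyclic_indicator_bounds[OF L] U0
    by (simp add: le_divide_eq mult_left_le)
  finally show ?thesis by (simp add: S_def mult_left_mono)
qed

subsection \<open>Popular sums that are not sums\<close>

text \<open>After exchanging the sums, each offset \<open>z\<close> gives the sum of
  \<open>G\<close> over an interval that misses at most \<open>L\<close> points of the full
  window.\<close>

lemma window_average_error:
  fixes G :: "nat \<Rightarrow> real"
  assumes L: "1 \<le> L" "L \<le> H" and G: "\<And>m. m \<in> {a+1..a+H} \<Longrightarrow> \<bar>G m\<bar> \<le> K" and K: "0 \<le> K"
  shows "\<bar>real L * (\<Sum>m=a+1..a+H. G m) - (\<Sum>i=a..a+H-L. \<Sum>z=1..L. G (i + z))\<bar> \<le> real L * (real L * K)"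
proof -
  have "(\<Sum>i=a..a+H-L. \<Sum>z=1..L. G (i + z)) = (\<Sum>z=1..L. \<Sum>i=a..a+H-L. G (i + z))"
    by (rule sum.swap)
  also have "\<dots> = (\<Sum>z=1..L. \<Sum>m=a+z..a+H-L+z. G m)"
    by (simp only: sum.shift_bounds_cl_nat_ivl)
  finally have "real L * (\<Sum>m=a+1..a+H. G m) - (\<Sum>i=a..a+H-L. \<Sum>z=1..L. G (i + z))
     = (\<Sum>z=1..L. (\<Sum>m=a+1..a+H. G m) - (\<Sum>m=a+z..a+H-L+z. G m))"
    by (simp add: sum_subtractf)
  also have "\<bar>\<dots>\<bar> \<le> (\<Sum>z=1..L. real L * K)"
  proof (intro order_trans[OF sum_abs] sum_mono)
    fix z assume z: "z \<in> {1..L}"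
    have sub: "{a+z..a+H-L+z} \<subseteq> {a+1..a+H}" using z L by auto
    have "(\<Sum>m=a+1..a+H. G m) - (\<Sum>m=a+z..a+H-L+z. G m) = (\<Sum>m\<in>{a+1..a+H} - {a+z..a+H-L+z}. G m)"
      by (subst sum_diff[OF _ sub]) auto
    also have "\<bar>\<dots>\<bar> \<le> (\<Sum>m\<in>{a+1..a+H} - {a+z..a+H-L+z}. K)"
      by (intro order_trans[OF sum_abs] sum_mono G) auto
    also have "\<dots> = real (card ({a+1..a+H} - {a+z..a+H-L+z})) * K" by simp
    also have "card ({a+1..a+H} - {a+z..a+H-L+z}) \<le> L"
      by (subst card_Diff_subset[OF _ sub]) (use L in auto)
    finally show "\<bar>(\<Sum>m=a+1..a+H. G m) - (\<Sum>m=a+z..a+H-L+z. G m)\<bar> \<le> real L * K"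
      using K by (auto simp: mult_right_mono)
  qed
  finally show ?thesis by simp
qed

text \<open>Here averaging over windows is exact: \<open>g\<close> vanishes off
  \<open>{1..int H}\<close>, and starting at \<open>1 - int L\<close> makes every support point
  appear once for each offset \<open>x\<close>.\<close>

lemma sum_windows_eq:
  fixes g :: "int \<Rightarrow> real"
  assumes g: "\<And>b. b \<notin> {1..int H} \<Longrightarrow> g b = 0"
  shows "(\<Sum>t\<in>{1 - int L..int H}. \<Sum>x<L. g (t + int x)) = real L * (\<Sum>b=1..H. g (int b))"
proof -
  have "(\<Sum>t\<in>{1 - int L..int H}. \<Sum>x<L. g (t + int x)) = (\<Sum>x<L. \<Sum>t\<in>{1 - int L..int H}. g (t + int x))"
    by (rule sum.swap)
  also have "\<dots> = (\<Sum>x<L. \<Sum>b\<in>{1..int H}. g b)"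
  proof (rule sum.cong[OF refl])
    fix x assume x: "x \<in> {..<L}"
    have "(\<Sum>t\<in>{1 - int L..int H}. g (t + int x)) = (\<Sum>u\<in>{1 - int L + int x..int H + int x}. g u)"
      by (rule sum.reindex_bij_witness[of _ "\<lambda>u. u - int x" "\<lambda>t. t + int x"]) auto
    also have "\<dots> = (\<Sum>b\<in>{1..int H}. g b)"
      by (rule sum.mono_neutral_right) (use x g in auto)
    finally show "(\<Sum>t\<in>{1 - int L..int H}. g (t + int x)) = (\<Sum>b\<in>{1..int H}. g b)" .
  qed
  also have "(\<Sum>b\<in>{1..int H}. g b) = (\<Sum>b=1..H. g (int b))"
    by (rule sum.reindex_bij_witness[of _ int nat]) auto
  finally show ?thesis by simp
qed

text \<open>Averaging \<open>m\<close> over windows of length \<open>L\<close> costs the boundary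
  term \<open>L * H\<close>; averaging \<open>b\<close> costs nothing. For each pair of windows
  there remains a bilinear sum in which \<open>q\<close> depends on the sum of the two local
  variables, so the \<open>U2_interval\<close> bound applies. The constant 12 is 6 times 2, as there
  are \<open>H + L\<close>, at most \<open>2 * H\<close>, windows for \<open>b\<close>.\<close>

lemma correlation_le_sum_U2_interval:
  fixes f :: "nat \<Rightarrow> real" and p q :: "int \<Rightarrow> real"
  assumes L: "1 \<le> L" "L \<le> H" and c: "H < c"
    and f: "\<And>m. m \<ge> 1 \<Longrightarrow> \<bar>f m\<bar> \<le> 1" and p: "\<And>b. \<bar>p b\<bar> \<le> 1" and q: "\<And>b. \<bar>q b\<bar> \<le> 1"
    and supp: "\<And>b. b \<notin> {1..int H} \<Longrightarrow> p b = 0"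
  shows "\<bar>\<Sum>m=c-H..<c. f m * (\<Sum>b=1..H. p (int b) * q (int b + int m - int c))\<bar>
    \<le> 12 * real H * (\<Sum>i=c-H-1..c-1-L. U2_interval i L (\<lambda>n. of_real (f n))) + real L * real H"
proof -
  \<comment> \<open>With this offset the range of \<open>m\<close> becomes
    \<open>{a+1..a+H}\<close>, in line with \<open>U2_interval i L\<close> living on
    \<open>{i+1..i+L}\<close>.\<close>
  define a where "a = c - H - 1"
  have ca: "c = a + H + 1" using c by (simp add: a_def)
  define G where "G m = f m * (\<Sum>b=1..H. p (int b) * q (int b + int m - int c))" for m
  define U where "U i = U2_interval i L (\<lambda>n. of_real (f n))" for i
  have G: "\<bar>G m\<bar> \<le> real H" if "m \<ge> 1" for m
  proof -
    have "\<bar>\<Sum>b=1..H. p (int b) * q (int b + int m - int c)\<bar> \<le> (\<Sum>b=1..H. 1)"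
      by (intro order_trans[OF sum_abs] sum_mono) (auto simp: abs_mult p q intro!: mult_le_one)
    then have "\<bar>f m\<bar> * \<bar>\<Sum>b=1..H. p (int b) * q (int b + int m - int c)\<bar> \<le> 1 * real H"
      using f[OF that] by (intro mult_mono) auto
    then show ?thesis by (simp add: G_def abs_mult)
  qed
  have inner: "\<bar>\<Sum>z=1..L. G (i + z)\<bar> \<le> 12 * real H * (real L * U i)" for i
  proof -
    have "real L * (\<Sum>z=1..L. G (i + z)) = (\<Sum>z=1..L. f (i + z) *
       (real L * (\<Sum>b=1..H. p (int b) * q (int b + int (i + z) - int c))))"
      by (simp add: G_def sum_distrib_left mult_ac)
    also have "\<dots> = (\<Sum>z=1..L. f (i + z) * (\<Sum>t\<in>{1 - int L..int H}. \<Sum>x<L.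
        p (t + int x) * q (t + int x + int (i + z) - int c)))"
      by (subst sum_windows_eq[where g = "\<lambda>b. p b * q (b + int (i + _) - int c)", symmetric])
         (simp_all add: supp)
    also have "\<dots> = (\<Sum>z=1..L. \<Sum>t\<in>{1 - int L..int H}. \<Sum>x<L.
        p (t + int x) * q (t + int (x + z) + int i - int c) * f (i + z))"
      by (simp add: sum_distrib_left algebra_simps)
    also have "\<dots> = (\<Sum>t\<in>{1 - int L..int H}. \<Sum>z=1..L. \<Sum>x<L.
        p (t + int x) * q (t + int (x + z) + int i - int c) * f (i + z))"
      by (rule sum.swap)
    also have "\<dots> = (\<Sum>t\<in>{1 - int L..int H}. \<Sum>x<L. \<Sum>z=1..L.
        p (t + int x) * q (t + int (x + z) + int i - int c) * f (i + z))"
      by (intro sum.cong refl sum.swap)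
    finally have "real L * \<bar>\<Sum>z=1..L. G (i + z)\<bar> = \<bar>\<Sum>t\<in>{1 - int L..int H}. \<Sum>x<L. \<Sum>z=1..L.
        p (t + int x) * q (t + int (x + z) + int i - int c) * f (i + z)\<bar>"
      by (metis abs_mult abs_of_nat)
    also have "\<dots> \<le> (\<Sum>t\<in>{1 - int L..int H}. 6 * (real L)\<^sup>2 * U i)"
      unfolding U_def
      by (intro order_trans[OF sum_abs] sum_mono
          bilinear_le_U2_interval[OF L(1), of "\<lambda>x. p (_ + int x)" "\<lambda>x. q (_ + int x + int i - int c)"] p q)
    also have "\<dots> = real (H + L) * (6 * (real L)\<^sup>2 * U i)" by (simp add: algebra_simps)
    also have "\<dots> \<le> (2 * real H) * (6 * (real L)\<^sup>2 * U i)"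
      using L by (intro mult_right_mono) (auto simp: U_def U2_interval_nonneg)
    also have "\<dots> = real L * (12 * real H * (real L * U i))" by (simp add: power2_eq_square)
    finally show ?thesis using L by simp
  qed
  have "\<bar>\<Sum>i=a..a+H-L. \<Sum>z=1..L. G (i + z)\<bar> \<le> (\<Sum>i=a..a+H-L. 12 * real H * (real L * U i))"
    by (intro order_trans[OF sum_abs] sum_mono inner)
  also have "\<dots> = real L * (12 * real H * (\<Sum>i=a..a+H-L. U i))"
    by (simp add: sum_distrib_left mult_ac)
  finally have "\<bar>\<Sum>i=a..a+H-L. \<Sum>z=1..L. G (i + z)\<bar> \<le> real L * (12 * real H * (\<Sum>i=a..a+H-L. U i))" .
  moreover have "\<bar>real L * (\<Sum>m=a+1..a+H. G m) - (\<Sum>i=a..a+H-L. \<Sum>z=1..L. G (i + z))\<bar> \<le> real L * (real L * real H)"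
    by (rule window_average_error[OF L]) (auto intro: G)
  ultimately have "\<bar>real L * (\<Sum>m=a+1..a+H. G m)\<bar> \<le>
     real L * (12 * real H * (\<Sum>i=a..a+H-L. U i)) + real L * (real L * real H)"
    by linarith
  then have "real L * \<bar>\<Sum>m=a+1..a+H. G m\<bar> \<le> real L * (12 * real H * (\<Sum>i=a..a+H-L. U i) + real L * real H)"
    by (simp add: abs_mult algebra_simps)
  then have "\<bar>\<Sum>m=a+1..a+H. G m\<bar> \<le> 12 * real H * (\<Sum>i=a..a+H-L. U i) + real L * real H"
    using L by (simp del: mult_cancel_left)
  moreover have "{c-H..<c} = {a+1..a+H}" "{c-H-1..c-1-L} = {a..a+H-L}" by (auto simp: ca)
  ultimately show ?thesis by (simp only: G_def U_def)
qed

section \<open>Wrap-around of popular sums\<close>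

text \<open>The bounds on \<open>e\<close>, \<open>b\<close> and \<open>x\<close> leave only
  \<open>e + b = x\<close> and \<open>e + b = x + Q\<close>. The first would make \<open>x\<close> a
  sum, so each representation wraps around once and is encoded by the point
  \<open>m = n + x - b\<close>, one period before the element of \<open>A\<close>.\<close>

lemma card_popular_fiber_le:
  fixes A B :: "nat set" and x :: int
  assumes HQ: "H \<le> Q" and n: "H < n" and B: "B \<subseteq> {1..H}" and x: "0 \<le> x" "x < int Q"
    and notin: "x \<notin> shift (A + B) n"
  shows "card {(e, f) \<in> ((\<lambda>a. a mod int Q) ` (shift A n \<inter> {0..<int Q})) \<times> ((\<lambda>a. a mod int Q) ` int ` B).
            (e + f) mod int Q = x mod int Q}
     \<le> card {m \<in> {n-H..<n}. m + Q \<in> A \<and> x + int n - int m \<in> int ` B}"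
  (is "card ?P \<le> card ?M")
proof -
  have "?P \<subseteq> (\<lambda>m. (int m + int Q - int n, (x + int n - int m) mod int Q)) ` ?M"
  proof clarify
    fix e f a b
    assume e: "e \<in> shift A n" "e \<in> {0..<int Q}" and b: "b \<in> B"
      and eq: "(e mod int Q + int b mod int Q) mod int Q = x mod int Q"
    obtain a where a: "a \<in> A" "e = int a - int n" using e by (auto simp: shift_def)
    have bH: "1 \<le> b" "b \<le> H" using b B by auto
    have "(e + int b) mod int Q = x mod int Q" using eq by (simp add: mod_add_eq)
    then have dvd: "int Q dvd e + int b - x" by (simp add: mod_eq_dvd_iff)
    then obtain k where k: "e + int b - x = int Q * k" by (auto elim: dvdE)
    have "- int Q < int Q * k" "int Q * k < int Q * 2" unfolding k[symmetric] using e bH x HQ by auto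
    have "k > -1"
    proof (rule ccontr)
      assume "\<not> k > -1"
      then have "int Q * k \<le> int Q * (-1)" by (intro mult_left_mono) auto
      then show False using \<open>- int Q < int Q * k\<close> by simp
    qed
    moreover have "k < 2"
    proof (rule ccontr)
      assume "\<not> k < 2"
      then have "int Q * 2 \<le> int Q * k" by (intro mult_left_mono) auto
      then show False using \<open>int Q * k < int Q * 2\<close> by simp
    qed
    ultimately have "k = 0 \<or> k = 1" by auto
    moreover have "k \<noteq> 0"
    proof
      assume "k = 0"
      then have "x = int (a + b) - int n" using k a by simp
      then have "x \<in> shift (A + B) n" unfolding shift_def using a b by (auto intro!: image_eqI[of _ _ "a + b"] set_plus_intro)
      then show False using notin by blast
    qed
    ultimately have k1: "e + int b = x + int Q" using k by auto
    define m where "m = a - Q"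
    have aQ: "a \<ge> Q" using k1 a n x bH HQ by linarith
    have m: "int m = int n + x - int b" using aQ k1 a by (simp add: m_def)
    have "x + int n - int m = int b" "m + Q = a" using m aQ by (auto simp: m_def)
    moreover have "m \<in> {n-H..<n}" using m bH x a(2) e k1 by auto
    ultimately have "m \<in> ?M" using a b by simp
    moreover have "e mod int Q = int m + int Q - int n" using e m k1 by simp
    moreover have "int b mod int Q = (x + int n - int m) mod int Q" using m by simp
    ultimately show "(e mod int Q, int b mod int Q) \<in> (\<lambda>m. (int m + int Q - int n, (x + int n - int m) mod int Q)) ` ?M"
      by blast
  qed
  then show ?thesis by (rule surj_card_le[rotated]) auto
qed

text \<open>Summing the fibre bound over \<open>S\<close> and exchanging sums turns the count into
  the sum of \<open>D m * R m\<close>. The structured part gives at most \<open>T\<close> times the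
  size of \<open>S\<close>, moved to the left; the uniform part gives two correlations, centred at
  \<open>n\<close> and \<open>n + Q\<close>, each bounded by
  \<open>12 * H * V + L * H\<close>.\<close>

lemma card_popular_sumset_diff_le:
  fixes A B :: "nat set" and g f :: "nat \<Rightarrow> real"
  assumes L: "1 \<le> L" "L \<le> H" and Q: "H \<le> Q" "Q \<le> 2 * H" and n: "H < n" and B: "B \<subseteq> {1..H}"
    and decomp: "\<And>m. m \<ge> 1 \<Longrightarrow> indicator A m = g m + f m"
    and f: "\<And>m. m \<ge> 1 \<Longrightarrow> \<bar>f m\<bar> \<le> 1"
    and T: "(\<Sum>m=n-H..<n. \<bar>g (m + Q) - g m\<bar>) \<le> T"
    and V: "(\<Sum>i=n-H-1..n+2*H. U2_interval i L (\<lambda>n. of_real (f n))) \<le> V"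
  shows "real (card (popular_sumset \<delta> Q (shift A n \<inter> {0..<int Q}) (int ` B) - shift (A + B) n \<inter> {0..<int Q}))
      * (\<delta> * real Q - T) \<le> 24 * real H * V + 2 * real L * real H"
proof -
  define S where "S = popular_sumset \<delta> Q (shift A n \<inter> {0..<int Q}) (int ` B) - shift (A + B) n \<inter> {0..<int Q}"
  define pB :: "int \<Rightarrow> real" where "pB = indicator (int ` B)"
  define qS :: "int \<Rightarrow> real" where "qS = indicator S"
  define R where "R m = (\<Sum>b=1..H. pB (int b) * qS (int b + int m - int n))" for m
  define D :: "nat \<Rightarrow> real" where "D m = indicator A (m + Q) - indicator A m" for m
  have SQ: "S \<subseteq> {0..<int Q}" by (auto simp: S_def popular_sumset_def)
  have finS: "finite S" using SQ by (rule finite_subset) simp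
  have SAB: "x \<notin> shift (A + B) n" if "x \<in> S" for x using that SQ by (auto simp: S_def)
  have pt: "\<delta> * real Q \<le> (\<Sum>m=n-H..<n. D m * pB (x + int n - int m))" if x: "x \<in> S" for x
  proof -
    have xQ: "0 \<le> x" "x < int Q" using x SQ by auto
    have "\<delta> * real Q \<le> real (card {(e, f) \<in> ((\<lambda>a. a mod int Q) ` (shift A n \<inter> {0..<int Q})) \<times> ((\<lambda>a. a mod int Q) ` int ` B).
            (e + f) mod int Q = x mod int Q})"
      using x unfolding S_def popular_sumset_def by (auto intro: less_imp_le)
    also have "\<dots> \<le> real (card {m \<in> {n-H..<n}. m + Q \<in> A \<and> x + int n - int m \<in> int ` B})"
      using card_popular_fiber_le[OF Q(1) n B xQ SAB[OF x]] by (simp only: of_nat_le_iff)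
    also have "\<dots> = (\<Sum>m\<in>{n-H..<n}. indicator {m. m + Q \<in> A \<and> x + int n - int m \<in> int ` B} m)"
      by (simp add: indicator_def Int_def sum.If_cases)
    also have "\<dots> = (\<Sum>m=n-H..<n. D m * pB (x + int n - int m))"
    proof (intro sum.cong refl)
      fix m
      show "indicator {m. m + Q \<in> A \<and> x + int n - int m \<in> int ` B} m = D m * pB (x + int n - int m)"
      proof (cases "x + int n - int m \<in> int ` B")
        case True
        then obtain b where b: "b \<in> B" "x + int n - int m = int b" by auto
        \<comment> \<open>This is why the difference \<open>D m\<close> may replace the single
          indicator of \<open>A\<close> at \<open>m + Q\<close>: its subtracted term vanishes
          wherever \<open>pB\<close> does not.\<close>
        have "m \<notin> A"
        proof
          assume "m \<in> A"
          then have "x \<in> shift (A + B) n" unfolding shift_def using b by (auto intro!: image_eqI[of _ _ "m + b"] set_plus_intro)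
          then show False using SAB[OF x] by simp
        qed
        then show ?thesis using True by (auto simp: D_def pB_def indicator_def)
      qed (auto simp: pB_def)
    qed
    finally show ?thesis .
  qed
  \<comment> \<open>For fixed \<open>m\<close> the points of \<open>S\<close> are counted by
    \<open>b = x + n - m\<close>, which gives the form that the correlation bound requires.\<close>
  have Req: "(\<Sum>x\<in>S. pB (x + int n - int m)) = R m" for m
  proof -
    have "(\<Sum>x\<in>S. pB (x + int n - int m)) = (\<Sum>x\<in>{x \<in> S. x + int n - int m \<in> int ` {1..H}}. pB (x + int n - int m))"
      using B finS by (intro sum.mono_neutral_right) (auto simp: pB_def indicator_def)
    also have "\<dots> = (\<Sum>b\<in>{b \<in> {1..H}. int b + int m - int n \<in> S}. pB (int b))"
      by (rule sum.reindex_bij_witness[of _ "\<lambda>b. int b + int m - int n" "\<lambda>x. nat (x + int n - int m)"]) auto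
    also have "\<dots> = R m"
      unfolding R_def by (rule sum.mono_neutral_cong_left) (auto simp: qS_def)
    finally show ?thesis .
  qed
  have R0: "0 \<le> R m" for m by (auto simp: R_def pB_def qS_def intro!: sum_nonneg)
  have RS: "R m \<le> real (card S)" for m
    unfolding Req[symmetric] using sum_bounded_above[of S "\<lambda>x. pB (x + int n - int m)" 1] by (simp add: pB_def indicator_def)
  have n1: "m \<ge> 1" if "m \<in> {n-H..<n}" for m using that n by auto
  \<comment> \<open>One bound \<open>V\<close> serves both centres, since
    \<open>Q \<le> 2 * H\<close> keeps their windows inside the range summed in
    \<open>V\<close>.\<close>
  have corr: "\<bar>\<Sum>m=c-H..<c. f m * (\<Sum>b=1..H. pB (int b) * qS (int b + int m - int c))\<bar>
    \<le> 12 * real H * V + real L * real H" if c: "n \<le> c" "c \<le> n + 2 * H" for c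
  proof -
    have "(\<Sum>i=c-H-1..c-1-L. U2_interval i L (\<lambda>n. of_real (f n))) \<le> V"
      by (rule order_trans[OF sum_mono2 V]) (use c in \<open>auto simp: U2_interval_nonneg\<close>)
    then have "12 * real H * (\<Sum>i=c-H-1..c-1-L. U2_interval i L (\<lambda>n. of_real (f n))) \<le> 12 * real H * V"
      by (intro mult_left_mono) auto
    moreover have "\<bar>\<Sum>m=c-H..<c. f m * (\<Sum>b=1..H. pB (int b) * qS (int b + int m - int c))\<bar>
      \<le> 12 * real H * (\<Sum>i=c-H-1..c-1-L. U2_interval i L (\<lambda>n. of_real (f n))) + real L * real H"
      using B c n by (intro correlation_le_sum_U2_interval L f) (auto simp: pB_def qS_def indicator_def)
    ultimately show ?thesis by linarith
  qed
  \<comment> \<open>Replacing \<open>m + Q\<close> by \<open>m\<close> moves the centre from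
    \<open>n\<close> to \<open>n + Q\<close> and leaves the argument of \<open>qS\<close>
    unchanged.\<close>
  have shiftQ: "(\<Sum>m=n-H..<n. f (m + Q) * R m)
     = (\<Sum>m=n+Q-H..<n+Q. f m * (\<Sum>b=1..H. pB (int b) * qS (int b + int m - int (n + Q))))"
    using n by (intro sum.reindex_bij_witness[of _ "\<lambda>m. m - Q" "\<lambda>m. m + Q"]) (auto simp: R_def algebra_simps)
  have "real (card S) * (\<delta> * real Q) \<le> (\<Sum>x\<in>S. \<Sum>m=n-H..<n. D m * pB (x + int n - int m))"
    using sum_bounded_below[of S "\<delta> * real Q"] pt by simp
  also have "\<dots> = (\<Sum>m=n-H..<n. \<Sum>x\<in>S. D m * pB (x + int n - int m))"
    by (rule sum.swap)
  also have "\<dots> = (\<Sum>m=n-H..<n. D m * R m)"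
    by (simp add: Req flip: sum_distrib_left)
  also have "\<dots> = (\<Sum>m=n-H..<n. (g (m + Q) - g m) * R m + f (m + Q) * R m - f m * R m)"
  proof (intro sum.cong refl)
    fix m assume "m \<in> {n-H..<n}"
    then have "indicator A m = g m + f m" "indicator A (m + Q) = g (m + Q) + f (m + Q)"
      using n1[of m] by (auto intro!: decomp)
    then show "D m * R m = (g (m + Q) - g m) * R m + f (m + Q) * R m - f m * R m"
      unfolding D_def by (simp only: algebra_simps)
  qed
  also have "\<dots> = (\<Sum>m=n-H..<n. (g (m + Q) - g m) * R m) + (\<Sum>m=n-H..<n. f (m + Q) * R m) - (\<Sum>m=n-H..<n. f m * R m)"
    by (simp add: sum.distrib sum_subtractf)
  also have "\<dots> \<le> real (card S) * T + (12 * real H * V + real L * real H) + (12 * real H * V + real L * real H)"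
  proof -
    have "(\<Sum>m=n-H..<n. (g (m + Q) - g m) * R m) \<le> (\<Sum>m=n-H..<n. \<bar>g (m + Q) - g m\<bar> * real (card S))"
      by (intro sum_mono mult_mono RS R0) auto
    also have "\<dots> \<le> real (card S) * T"
      using mult_right_mono[OF T, of "real (card S)"] by (simp add: sum_distrib_left mult.commute)
    finally show ?thesis
      using corr[of n, folded R_def] corr[of "n + Q", folded shiftQ] Q by linarith
  qed
  finally show ?thesis by (simp add: S_def algebra_simps)
qed

subsection \<open>Almost periods under the gap condition\<close>

lemma norm_T_eq_round: "norm_T x = \<bar>x - of_int (round x)\<bar>"
proof (rule antisym)
  show "norm_T x \<le> \<bar>x - of_int (round x)\<bar>"
    unfolding norm_T_def using infdist_le[of "of_int (round x)" \<int> x] by (simp add: dist_real_def)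
  show "\<bar>x - of_int (round x)\<bar> \<le> norm_T x"
    unfolding norm_T_def infdist_def
    by (auto intro!: cINF_greatest simp: dist_real_def round_diff_minimal elim!: Ints_cases)
qed

lemma norm_T_le_half: "norm_T x \<le> 1 / 2"
  unfolding norm_T_eq_round using of_int_round_abs_le[of x] by (simp add: abs_minus_commute)

lemma norm_T_nonneg: "0 \<le> norm_T x"
  by (simp add: norm_T_eq_round)

lemma e_circ_eq_cis: "e_circ x = cis (2 * pi * x)"
  by (simp add: e_circ_def cis_conv_exp mult_ac)

lemma e_circ_diff_int: "e_circ (x - of_int m) = e_circ x"
proof -
  have "cis (2 * pi * of_int m) = 1" by (rule cis_multiple_2pi) simp
  then show ?thesis by (simp add: e_circ_eq_cis right_diff_distrib flip: cis_divide)
qed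

lemma norm_e_circ_minus_one: "cmod (e_circ x - 1) = 2 * sin (pi * norm_T x)"
proof -
  define y where "y = x - of_int (round x)"
  have "e_circ x = e_circ y" by (simp add: y_def e_circ_diff_int)
  also have "\<dots> = exp (\<i> * of_real (2 * pi * y))" by (simp add: e_circ_def mult_ac)
  finally have "cmod (e_circ x - 1) = 2 * \<bar>sin (pi * y)\<bar>"
    using dist_exp_i_1[of "2 * pi * y"] by simp
  also have "\<bar>sin (pi * y)\<bar> = \<bar>sin (pi * \<bar>y\<bar>)\<bar>" by (auto simp: abs_if)
  also have "\<dots> = sin (pi * \<bar>y\<bar>)"
    using norm_T_le_half[of x] by (intro abs_of_nonneg sin_ge_zero) (auto simp: y_def norm_T_eq_round)
  finally show ?thesis by (simp add: y_def norm_T_eq_round)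
qed

lemma norm_e_circ_minus_one_le: "cmod (e_circ x - 1) \<le> 2 * pi * norm_T x"
  using sin_x_le_x[of "pi * norm_T x"] norm_T_nonneg[of x]
  by (simp add: norm_e_circ_minus_one)

text \<open>A weak form of Jordan's inequality. On \<open>[0, 2]\<close> the cubic Taylor bound
  gives \<open>sin y \<ge> y - y ^ 3 / 6 \<ge> y / 3\<close>, and \<open>pi > 3\<close> absorbs the
  factor 3.\<close>

lemma norm_e_circ_minus_one_ge: "2 * norm_T x \<le> cmod (e_circ x - 1)"
proof -
  define y where "y = pi * norm_T x"
  have y: "0 \<le> y" "y \<le> 2"
    using norm_T_nonneg[of x] norm_T_le_half[of x] pi_less_4 mult_mono[of pi 4 "norm_T x" "1/2"]
    by (auto simp: y_def)
  have "\<bar>sin y - (\<Sum>m<3. sin_coeff m * y ^ m)\<bar> \<le> inverse (fact 3) * \<bar>y\<bar> ^ 3"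
    by (rule Maclaurin_sin_bound)
  moreover have "(\<Sum>m<3. sin_coeff m * y ^ m) = y"
    by (simp add: sin_coeff_def eval_nat_numeral)
  ultimately have "y - y ^ 3 / 6 \<le> sin y"
    using y by (simp add: fact_numeral abs_if split: if_splits)
  moreover have "y ^ 3 \<le> 4 * y"
    using y mult_mono[of y 2 y 2] mult_right_mono[of "y * y" 4 y] by (simp add: power3_eq_cube)
  ultimately have "y / 3 \<le> sin y" by simp
  moreover have "3 * norm_T x \<le> y"
    using pi_gt3 norm_T_nonneg[of x] by (simp add: y_def mult_right_mono)
  ultimately show ?thesis by (simp add: norm_e_circ_minus_one y_def)
qed

lemma cos_2pi_norm_T: "cos (2 * pi * norm_T x) = cos (2 * pi * x)"
proof -
  have "cos (2 * pi * x) = Re (e_circ (x - of_int (round x)))"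
    unfolding e_circ_diff_int by (simp add: e_circ_eq_cis)
  then have "cos (2 * pi * x) = cos \<bar>2 * pi * (x - of_int (round x))\<bar>"
    by (simp only: cos_abs_real e_circ_eq_cis cis.sel)
  then show ?thesis by (simp add: norm_T_eq_round abs_mult)
qed

lemma e_circ_add: "e_circ (x + y) = e_circ x * e_circ y"
  by (simp add: e_circ_eq_cis cis_mult distrib_left)

lemma e_circ_sum: "e_circ (sum f I) = (\<Prod>i\<in>I. e_circ (f i))"
proof (induction I rule: infinite_finite_induct)
qed (auto simp: e_circ_add, auto simp: e_circ_eq_cis)

lemma e_circ_of_nat_mult: "e_circ (of_nat q * x) = e_circ x ^ q"
  by (simp add: e_circ_eq_cis Complex.DeMoivre mult_ac)

lemma norm_e_circ [simp]: "cmod (e_circ x) = 1"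
  by (simp add: e_circ_eq_cis)

text \<open>The sum is geometric with ratio \<open>e_circ \<beta>\<close>: the numerator is at most
  2 and the denominator at least \<open>2 * norm_T \<beta>\<close>.\<close>

lemma norm_sum_e_circ_le:
  assumes "norm_T \<beta> > 0"
  shows "cmod (\<Sum>q=a..b. e_circ (of_nat q * \<beta>)) \<le> 1 / norm_T \<beta>"
proof -
  define z where "z = e_circ \<beta>"
  have z: "cmod z = 1" by (simp add: z_def)
  have g: "2 * norm_T \<beta> \<le> cmod (1 - z)"
    using norm_e_circ_minus_one_ge[of \<beta>] by (simp add: z_def norm_minus_commute)
  have z1: "z \<noteq> 1" using g assms by auto
  have "(\<Sum>q=a..b. e_circ (of_nat q * \<beta>)) = (\<Sum>q=a..b. z ^ q)"
    by (simp add: e_circ_of_nat_mult z_def)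
  also have "\<dots> = (if b < a then 0 else (z ^ a - z ^ Suc b) / (1 - z))"
    using z1 by (simp add: sum_gp)
  also have "cmod \<dots> \<le> 2 / cmod (1 - z)"
  proof -
    have "cmod (z ^ a - z ^ Suc b) \<le> 1 + 1"
      using z by (intro order_trans[OF norm_triangle_ineq4]) (simp add: norm_power norm_mult)
    then show ?thesis by (simp add: norm_divide divide_right_mono)
  qed
  also have "\<dots> \<le> 2 / (2 * norm_T \<beta>)"
    using g assms by (intro divide_left_mono) (auto intro!: mult_pos_pos)
  finally show ?thesis by simp
qed

lemma Re_e_circ_nonneg:
  assumes "real q * norm_T \<beta> \<le> 1 / 4"
  shows "0 \<le> Re (e_circ (of_nat q * \<beta>))"
proof -
  define y where "y = \<beta> - of_int (round \<beta>)"
  have "e_circ (of_nat q * \<beta>) = e_circ (of_nat q * y)"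
    by (simp only: e_circ_of_nat_mult y_def e_circ_diff_int)
  moreover have "0 \<le> cos (2 * pi * (of_nat q * y))"
  proof -
    have "\<bar>real q * y\<bar> \<le> 1 / 4" using assms by (simp add: norm_T_eq_round y_def abs_mult)
    then have "\<bar>2 * pi * (real q * y)\<bar> \<le> 2 * pi * (1 / 4)"
      unfolding abs_mult[of "2 * pi"] by (intro mult_mono) auto
    then have "- (pi / 2) \<le> 2 * pi * (real q * y)" "2 * pi * (real q * y) \<le> pi / 2"
      unfolding abs_le_iff by linarith+
    then show ?thesis by (rule cos_ge_zero)
  qed
  ultimately show ?thesis by (simp add: e_circ_eq_cis)
qed

section \<open>Fourier expansion of the almost-period weight\<close>

text \<open>With \<open>z = e_circ x\<close> the base equals
  \<open>cnj z * (z + 1)\<^sup>2 / 4\<close>, so the binomial theorem applies with exponent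
  \<open>2 * k\<close>. All coefficients are nonnegative, and \<open>j = k\<close> carries the
  constant term.\<close>

lemma half_one_plus_cos_power_expand:
  "complex_of_real (((1 + cos (2 * pi * x)) / 2) ^ k) =
     (\<Sum>j\<le>2*k. of_real (real (2 * k choose j) / 4 ^ k) * e_circ ((real j - real k) * x))"
proof -
  define z where "z = e_circ x"
  have zc: "z * cnj z = 1"
    using complex_norm_square[of z] by (simp add: z_def)
  have "complex_of_real ((1 + cos (2 * pi * x)) / 2) = (2 + z + cnj z) / 4"
    by (simp add: complex_eq_iff z_def e_circ_eq_cis)
  also have "\<dots> = cnj z * (z + 1)\<^sup>2 / 4"
    using zc by (simp add: power2_eq_square algebra_simps)
  finally have "complex_of_real (((1 + cos (2 * pi * x)) / 2) ^ k) = cnj z ^ k * (z + 1) ^ (2 * k) / 4 ^ k"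
    by (simp only: of_real_power) (simp add: power_divide power_mult_distrib power_mult)
  also have "(z + 1) ^ (2 * k) = (\<Sum>j\<le>2*k. of_nat (2 * k choose j) * z ^ j)"
    by (subst binomial_ring) simp
  also have "cnj z ^ k * (\<Sum>j\<le>2*k. of_nat (2 * k choose j) * z ^ j) / 4 ^ k =
     (\<Sum>j\<le>2*k. of_nat (2 * k choose j) / 4 ^ k * (cnj z ^ k * z ^ j))"
    by (simp add: sum_distrib_left sum_divide_distrib mult_ac)
  also have "\<dots> = (\<Sum>j\<le>2*k. of_real (real (2 * k choose j) / 4 ^ k) * e_circ ((real j - real k) * x))"
  proof (intro sum.cong refl)
    fix j
    have "e_circ ((real j - real k) * x) = cis (real j * (2 * pi * x)) * cis (real k * (- (2 * pi * x)))"
      by (simp add: e_circ_eq_cis cis_mult algebra_simps)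
    also have "\<dots> = cnj z ^ k * z ^ j"
      by (simp only: z_def e_circ_eq_cis cis_cnj Complex.DeMoivre mult.commute)
    finally show "of_nat (2 * k choose j) / 4 ^ k * (cnj z ^ k * z ^ j)
       = of_real (real (2 * k choose j) / 4 ^ k) * e_circ ((real j - real k) * x)" by simp
  qed
  finally show ?thesis .
qed

text \<open>When the product is multiplied out, a function \<open>w\<close> selects one frequency
  from each factor. Real parts may be taken because the left side and the coefficients are
  real.\<close>

lemma prod_half_one_plus_cos_expand:
  assumes "finite I"
  shows "(\<Prod>i\<in>I. ((1 + cos (2 * pi * (real q * y i))) / 2) ^ k) =
     (\<Sum>w\<in>I \<rightarrow>\<^sub>E {..2*k}. (\<Prod>i\<in>I. real (2 * k choose w i) / 4 ^ k) *
        Re (e_circ (real q * (\<Sum>i\<in>I. (real (w i) - real k) * y i))))"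
proof -
  have "complex_of_real (\<Prod>i\<in>I. ((1 + cos (2 * pi * (real q * y i))) / 2) ^ k) =
    (\<Prod>i\<in>I. \<Sum>j\<le>2*k. of_real (real (2 * k choose j) / 4 ^ k) * e_circ ((real j - real k) * (real q * y i)))"
    by (simp only: of_real_prod half_one_plus_cos_power_expand)
  also have "\<dots> = (\<Sum>w\<in>I \<rightarrow>\<^sub>E {..2*k}. \<Prod>i\<in>I. of_real (real (2 * k choose w i) / 4 ^ k) *
        e_circ ((real (w i) - real k) * (real q * y i)))"
    by (rule prod_sum_PiE) (use assms in auto)
  also have "\<dots> = (\<Sum>w\<in>I \<rightarrow>\<^sub>E {..2*k}. of_real (\<Prod>i\<in>I. real (2 * k choose w i) / 4 ^ k) *
        e_circ (real q * (\<Sum>i\<in>I. (real (w i) - real k) * y i)))"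
    by (simp only: prod.distrib of_real_prod e_circ_sum sum_distrib_left mult_ac)
  finally have "Re (complex_of_real (\<Prod>i\<in>I. ((1 + cos (2 * pi * (real q * y i))) / 2) ^ k)) =
    Re (\<Sum>w\<in>I \<rightarrow>\<^sub>E {..2*k}. of_real (\<Prod>i\<in>I. real (2 * k choose w i) / 4 ^ k) *
        e_circ (real q * (\<Sum>i\<in>I. (real (w i) - real k) * y i)))" by simp
  then show ?thesis by (simp only: Re_complex_of_real Re_sum Re_complex_of_real scaleR_conv_of_real[symmetric] scaleR_complex.sel real_scaleR_def)
qed

text \<open>For \<open>k > 0\<close> the constant Fourier coefficient is at least
  \<open>(1 / (2 * k)) ^ d\<close>, polynomially small, while \<open>\<gamma> ^ k\<close> decays
  exponentially. Writing \<open>\<gamma>\<close> as \<open>\<rho> ^ d\<close> reduces the comparison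
  to \<open>k * \<rho> ^ k\<close> tending to 0.\<close>

lemma exists_power_less_central_coeff:
  assumes "0 \<le> \<gamma>" "\<gamma> < 1"
  shows "\<exists>k::nat. \<gamma> ^ k \<le> (real (2 * k choose k) / 4 ^ k) ^ d / 2"
proof (cases "d = 0")
  case True
  have "(\<lambda>k. \<gamma> ^ k) \<longlonglongrightarrow> 0" using assms by (simp add: LIMSEQ_power_zero)
  then have "eventually (\<lambda>k. \<gamma> ^ k < 1 / 2) sequentially" by (rule order_tendstoD) simp
  then obtain k where "\<gamma> ^ k < 1 / 2" by (auto dest!: eventually_happens)
  then show ?thesis using True by (intro exI[of _ k]) simp
next
  case False
  define \<rho> where "\<rho> = root d \<gamma>"
  have \<rho>: "0 \<le> \<rho>" "\<rho> < 1" "\<rho> ^ d = \<gamma>" using False assms by (auto simp: \<rho>_def)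
  have "(\<lambda>k. (2 * (real k * \<rho> ^ k)) ^ d) \<longlonglongrightarrow> (2 * 0) ^ d"
    using \<rho> by (intro tendsto_intros powser_times_n_limit_0) auto
  then have "eventually (\<lambda>k. (2 * (real k * \<rho> ^ k)) ^ d < 1 / 2) sequentially"
    by (rule order_tendstoD) (use False in \<open>simp add: power_0_left\<close>)
  then have "eventually (\<lambda>k. (2 * (real k * \<rho> ^ k)) ^ d < 1 / 2 \<and> k > 0) sequentially"
    by (intro eventually_conj eventually_gt_at_top)
  then obtain k where k: "(2 * (real k * \<rho> ^ k)) ^ d < 1 / 2" "k > 0"
    by (auto dest!: eventually_happens)
  have "\<gamma> ^ k = (\<rho> ^ k) ^ d" by (metis \<rho>(3) mult.commute power_mult)
  also have "\<dots> = (1 / (2 * real k)) ^ d * (2 * (real k * \<rho> ^ k)) ^ d"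
    unfolding power_mult_distrib[symmetric] using k by simp
  also have "\<dots> \<le> (1 / (2 * real k)) ^ d * (1 / 2)"
    using k by (intro mult_left_mono) auto
  also have "\<dots> \<le> (real (2 * k choose k) / 4 ^ k) ^ d * (1 / 2)"
    using central_binomial_lower_bound[OF k(2)] k
    by (intro mult_right_mono power_mono) (auto simp: field_simps)
  finally show ?thesis by auto
qed


text \<open>\<open>C\<close> and \<open>H\<^sub>0\<close> depend on \<open>\<epsilon>\<close>,
  \<open>d\<close> and \<open>W\<close> alone, hence serve all windows at once. If no multiple of
  \<open>W\<close> were suitable, the weight would be at most half its constant coefficient
  \<open>a0\<close> throughout \<open>J\<close>; but its sum over \<open>J\<close> is at least
  \<open>a0 * l - H / C\<close>, which is too large for the chosen \<open>C\<close>.\<close>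

lemma exists_bohr_recurrence:
  fixes \<epsilon> :: real and d W :: nat
  assumes \<epsilon>: "\<epsilon> > 0" and W: "W \<ge> 1"
  shows "\<exists>C\<ge>1. \<exists>H\<^sub>0. \<forall>H\<ge>H\<^sub>0. \<forall>\<alpha> :: nat \<Rightarrow> real.
    (\<forall>w :: nat \<Rightarrow> int. (\<forall>i\<in>{1..d}. \<bar>real_of_int (w i)\<bar> \<le> C) \<longrightarrow>
       norm_T (\<Sum>i=1..d. real_of_int (w i) * \<alpha> i) \<le> 1 / (C * real H) \<or>
       norm_T (\<Sum>i=1..d. real_of_int (w i) * \<alpha> i) \<ge> C / real H) \<longrightarrow>
    (\<exists>Q. W dvd Q \<and> H \<le> Q \<and> real Q \<le> (1 + \<epsilon>) * real H \<and> (\<forall>i\<in>{1..d}. norm_T (real Q * \<alpha> i) \<le> \<epsilon>))"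
proof -
  \<comment> \<open>The cap 1/2 keeps \<open>2 * pi * e\<close> in \<open>[0, pi]\<close>, where the
    cosine decreases.\<close>
  define e where "e = min \<epsilon> (1 / 2)"
  have e: "0 < e" "e \<le> \<epsilon>" "e \<le> 1 / 2" using \<epsilon> by (auto simp: e_def)
  define \<gamma> where "\<gamma> = (1 + cos (2 * pi * e)) / 2"
  have "cos (2 * pi * e) < cos 0" using e by (intro cos_monotone_0_pi) auto
  then have \<gamma>: "0 \<le> \<gamma>" "\<gamma> < 1" by (auto simp: \<gamma>_def) (smt (verit) cos_ge_minus_one)
  obtain k where k: "\<gamma> ^ k \<le> (real (2 * k choose k) / 4 ^ k) ^ d / 2"
    using exists_power_less_central_coeff[OF \<gamma>] by blast
  define a0 where "a0 = (real (2 * k choose k) / 4 ^ k) ^ d"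
  have a0: "a0 > 0" by (auto simp: a0_def)
  \<comment> \<open>The 8 makes cosines at tiny frequencies nonnegative, \<open>W * k\<close> bounds
    the integer coefficients to which the gap condition is applied, and the last summand makes the
    error \<open>H / C\<close> smaller than half the main term.\<close>
  define C where "C = 8 + real W * real k + 8 * real W / (e * a0)"
  have C: "C \<ge> 8" "C \<ge> real W * real k" "C > 4 * real W / (e * a0)"
  proof -
    define r where "r = real W / (e * a0)"
    have "r > 0" using e a0 W by (simp add: r_def)
    define t where "t = real W * real k"
    have "t \<ge> 0" by (simp add: t_def)
    moreover have "C = 8 + t + 8 * r" by (simp add: C_def r_def t_def)
    ultimately have "C \<ge> 8" "C \<ge> t" "C > 4 * r" using \<open>r > 0\<close> by linarith+
    then show "C \<ge> 8" "C \<ge> real W * real k" "C > 4 * real W / (e * a0)"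
      by (simp_all add: r_def t_def)
  qed
  \<comment> \<open>From here on \<open>e * H / W \<ge> 2\<close>, so rounding it down to
    \<open>l\<close> loses at most half.\<close>
  define H\<^sub>0 where "H\<^sub>0 = nat \<lceil>2 * real W / e\<rceil> + 1"
  have main: "\<exists>Q. W dvd Q \<and> H \<le> Q \<and> real Q \<le> (1 + \<epsilon>) * real H \<and> (\<forall>i\<in>{1..d}. norm_T (real Q * \<alpha> i) \<le> \<epsilon>)"
    if H: "H \<ge> H\<^sub>0" and gap: "\<And>w :: nat \<Rightarrow> int. (\<forall>i\<in>{1..d}. \<bar>real_of_int (w i)\<bar> \<le> C) \<Longrightarrow>
       norm_T (\<Sum>i=1..d. real_of_int (w i) * \<alpha> i) \<le> 1 / (C * real H) \<or>
       norm_T (\<Sum>i=1..d. real_of_int (w i) * \<alpha> i) \<ge> C / real H" for H and \<alpha> :: "nat \<Rightarrow> real"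
  proof (rule ccontr)
    assume none: "\<not> ?thesis"
    have H1: "2 * real W / e \<le> real H" and Hpos: "real H > 0" using H unfolding H\<^sub>0_def by linarith+
    define l where "l = nat \<lfloor>e * real H / real W\<rfloor>"
    \<comment> \<open>\<open>W * a\<close> is the first multiple of \<open>W\<close> strictly above
      \<open>H\<close>.\<close>
    define a where "a = H div W + 1"
    have eHW: "2 \<le> e * real H / real W" using H1 e W by (simp add: field_simps)
    have l_up: "real l \<le> e * real H / real W" and l_lo: "e * real H / (2 * real W) \<le> real l" and l1: "l \<ge> 1"
    proof -
      show "real l \<le> e * real H / real W" using eHW by (simp add: l_def)
      have "e * real H / real W - 1 \<le> real l" using eHW unfolding l_def by linarith
      moreover have "e * real H / (2 * real W) = e * real H / real W / 2" by simp
      ultimately show "e * real H / (2 * real W) \<le> real l" using eHW by linarith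
      then show "l \<ge> 1" using eHW \<open>e * real H / (2 * real W) = e * real H / real W / 2\<close>
        by linarith
    qed
    define J where "J = {a..a + l - 1}"
    have cardJ: "card J = l" using l1 by (simp add: J_def)
    have Jrange: "H \<le> W * q \<and> real (W * q) \<le> (1 + e) * real H" if "q \<in> J" for q
    proof
      have "H \<le> W * a"
        using W mult_div_mod_eq[of W H] mod_less_divisor[of W H] unfolding a_def distrib_left mult_1_right by linarith
      also have "\<dots> \<le> W * q" using that by (simp add: J_def)
      finally show "H \<le> W * q" .
      have "q \<le> H div W + l" using that l1 by (auto simp: J_def a_def)
      then have "W * q \<le> W * (H div W) + W * l" by (metis add_mult_distrib2 mult_le_mono2)
      also have "\<dots> \<le> H + W * l" by simp
      finally have "real (W * q) \<le> real H + real W * real l" by (simp flip: of_nat_mult of_nat_add)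
      also have "real W * real l \<le> e * real H" using l_up W by (simp add: field_simps)
      finally show "real (W * q) \<le> (1 + e) * real H" by (simp add: algebra_simps)
    qed
    define R where "R q = (\<Prod>i=1..d. ((1 + cos (2 * pi * (real q * (real W * \<alpha> i)))) / 2) ^ k)" for q
    define c where "c w = (\<Prod>i=1..d. real (2 * k choose w i) / 4 ^ k)" for w
    define \<beta> where "\<beta> w = (\<Sum>i=1..d. (real (w i) - real k) * (real W * \<alpha> i))" for w
    define \<Omega> where "\<Omega> = {1..d} \<rightarrow>\<^sub>E {..2*k}"
    \<comment> \<open>This choice gives the zero frequency.\<close>
    define w0 where "w0 = (\<lambda>i\<in>{1..d}. k)"
    have fin: "finite \<Omega>" and w0: "w0 \<in> \<Omega>" by (auto simp: \<Omega>_def w0_def intro!: finite_PiE)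
    have Rexp: "R q = (\<Sum>w\<in>\<Omega>. c w * Re (e_circ (real q * \<beta> w)))" for q
      unfolding R_def c_def \<beta>_def \<Omega>_def by (rule prod_half_one_plus_cos_expand) simp
    have c0: "c w \<ge> 0" for w by (auto simp: c_def intro!: prod_nonneg)
    \<comment> \<open>At \<open>q = 0\<close> every cosine and every exponential is 1.\<close>
    have csum: "(\<Sum>w\<in>\<Omega>. c w) = 1" using Rexp[of 0] by (simp add: R_def e_circ_eq_cis)
    have cw0: "c w0 = a0" by (simp add: c_def w0_def a0_def)
    have upper: "R q \<le> a0 / 2" if q: "q \<in> J" for q
    proof -
      have "(1 + e) * real H \<le> (1 + \<epsilon>) * real H" using e by (intro mult_right_mono) auto
      then have "\<not> (\<forall>i\<in>{1..d}. norm_T (real (W * q) * \<alpha> i) \<le> \<epsilon>)"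
        using none Jrange[OF q] by (meson dvd_triv_left order_trans)
      then obtain i where i: "i \<in> {1..d}" "norm_T (real (W * q) * \<alpha> i) > \<epsilon>" by force
      have fac: "0 \<le> (1 + cos x) / 2" "(1 + cos x) / 2 \<le> 1" for x :: real
        using add_left_mono[OF cos_ge_minus_one, of 1 x] by simp_all
      define y where "y = real q * (real W * \<alpha> i)"
      have "e \<le> norm_T y" using i e by (simp add: y_def mult_ac)
      then have "cos (2 * pi * norm_T y) \<le> cos (2 * pi * e)"
        using e norm_T_le_half[of y] by (intro cos_monotone_0_pi_le) auto
      then have "(1 + cos (2 * pi * y)) / 2 \<le> \<gamma>"
        by (simp add: cos_2pi_norm_T \<gamma>_def)
      then have y: "((1 + cos (2 * pi * y)) / 2) ^ k \<le> \<gamma> ^ k"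
        using fac by (intro power_mono)
      have "R q = ((1 + cos (2 * pi * y)) / 2) ^ k *
         (\<Prod>j\<in>{1..d} - {i}. ((1 + cos (2 * pi * (real q * (real W * \<alpha> j)))) / 2) ^ k)"
        unfolding R_def y_def using i by (intro prod.remove) auto
      also have "\<dots> \<le> \<gamma> ^ k * 1"
        using \<gamma> fac by (intro mult_mono y prod_le_1 prod_nonneg) (auto intro!: power_le_one zero_le_power)
      finally show ?thesis using k by (simp add: a0_def)
    qed
    define S where "S w = (\<Sum>q\<in>J. Re (e_circ (real q * \<beta> w)))" for w
    \<comment> \<open>A one-sided bound suffices because all \<open>c w\<close> are nonnegative:
      small frequencies contribute nonnegatively, and large ones at least
      \<open>- H / C\<close>.\<close>
    have lower: "(if w = w0 then real l else 0) - real H / C \<le> S w" if w: "w \<in> \<Omega>" for w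
    proof (cases "w = w0")
      case True
      have "\<beta> w = 0" by (auto simp: True \<beta>_def w0_def)
      then show ?thesis using True Hpos C cardJ by (simp add: S_def e_circ_eq_cis)
    next
      case False
      have \<beta>w: "\<beta> w = (\<Sum>i=1..d. real_of_int (int W * (int (w i) - int k)) * \<alpha> i)"
        by (simp add: \<beta>_def mult_ac)
      have "\<bar>real_of_int (int W * (int (w i) - int k))\<bar> \<le> C" if "i \<in> {1..d}" for i
      proof -
        have "w i \<le> 2 * k" using w that by (auto simp: \<Omega>_def)
        then have "\<bar>real (w i) - real k\<bar> \<le> real k" by linarith
        then have "real W * \<bar>real (w i) - real k\<bar> \<le> real W * real k" by (intro mult_left_mono) auto
        then show ?thesis using C by (simp add: abs_mult)
      qed
      then consider "norm_T (\<beta> w) \<le> 1 / (C * real H)" | "norm_T (\<beta> w) \<ge> C / real H"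
        using gap[of "\<lambda>i. int W * (int (w i) - int k)"] unfolding \<beta>w by blast
      then show ?thesis
      proof cases
        case 1
        have "0 \<le> Re (e_circ (real q * \<beta> w))" if "q \<in> J" for q
        proof (rule Re_e_circ_nonneg)
          have "real q \<le> real (W * q)" using W by (cases W) auto
          also have "\<dots> \<le> (1 + e) * real H" using Jrange[OF that] by simp
          also have "\<dots> \<le> 2 * real H" using e by (intro mult_right_mono) auto
          finally have "real q * norm_T (\<beta> w) \<le> 2 * real H * (1 / (C * real H))"
            using 1 by (intro mult_mono) (auto simp: norm_T_nonneg)
          also have "\<dots> = 2 / C" using Hpos by simp
          also have "\<dots> \<le> 1 / 4" using C by (simp add: divide_simps)
          finally show "real q * norm_T (\<beta> w) \<le> 1 / 4" .
        qed
        then have "0 \<le> S w" by (auto simp: S_def intro: sum_nonneg)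
        moreover have "0 \<le> real H / C" using C by simp
        ultimately show ?thesis using False by simp
      next
        case 2
        have pos: "0 < C / real H" using C Hpos by simp
        have "\<bar>S w\<bar> = \<bar>Re (\<Sum>q\<in>J. e_circ (real q * \<beta> w))\<bar>" by (simp add: S_def)
        also have "\<dots> \<le> cmod (\<Sum>q\<in>J. e_circ (real q * \<beta> w))" by (rule abs_Re_le_cmod)
        also have "\<dots> \<le> 1 / norm_T (\<beta> w)"
          unfolding J_def using 2 pos by (intro norm_sum_e_circ_le) linarith
        also have "\<dots> \<le> 1 / (C / real H)"
          using 2 pos by (intro divide_left_mono mult_pos_pos) linarith+
        finally show ?thesis using False by simp
      qed
    qed
    have "a0 * real l - real H / C = (\<Sum>w\<in>\<Omega>. c w * ((if w = w0 then real l else 0) - real H / C))"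
    proof -
      have "(\<Sum>w\<in>\<Omega>. c w * ((if w = w0 then real l else 0) - real H / C))
        = (\<Sum>w\<in>\<Omega>. (if w = w0 then c w * real l else 0) - c w * (real H / C))"
        by (intro sum.cong) (auto simp: algebra_simps)
      also have "\<dots> = a0 * real l - (\<Sum>w\<in>\<Omega>. c w) * (real H / C)"
        unfolding sum_subtractf sum_distrib_right using fin w0 by (simp add: cw0)
      finally show ?thesis by (simp add: csum)
    qed
    also have "\<dots> \<le> (\<Sum>w\<in>\<Omega>. c w * S w)"
      by (intro sum_mono mult_left_mono lower c0)
    also have "\<dots> = (\<Sum>q\<in>J. R q)"
      unfolding S_def Rexp by (simp add: sum_distrib_left) (rule sum.swap)
    also have "\<dots> \<le> real l * (a0 / 2)"
      using sum_bounded_above[of J R "a0 / 2"] upper by (simp add: cardJ)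
    finally have "a0 * real l \<le> 2 * real H / C" by (simp add: mult.commute)
    moreover have "a0 * (e * real H / (2 * real W)) \<le> a0 * real l" using a0 l_lo by (intro mult_left_mono) auto
    ultimately have "a0 * (e * real H / (2 * real W)) \<le> 2 * real H / C" by linarith
    then have "C \<le> 4 * real W / (e * a0)"
      using a0 e W C Hpos by (simp add: field_simps)
    then show False using C by simp
  qed
  show ?thesis
  proof (rule exI[of _ C], rule conjI)
    show "1 \<le> C" using C by simp
  qed (rule exI[of _ H\<^sub>0], intro allI impI, rule main, assumption, blast)
qed

subsection \<open>Most windows have an admissible modulus\<close>

text \<open>One parameter \<open>K\<close> controls the divisor, the interval for \<open>Q\<close>,
  the popularity threshold and the error, so that the final choice has a single quantity to send to
  infinity.\<close>

definition admissible_modulus :: "nat set \<Rightarrow> nat \<Rightarrow> nat \<Rightarrow> nat \<Rightarrow> nat \<Rightarrow> bool" where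
  "admissible_modulus A K h n Q \<longleftrightarrow>
     fact K dvd Q \<and> h \<le> Q \<and> real Q \<le> (1 + 1 / real K) * real h \<and>
     (\<forall>B \<subseteq> {1..h}.
        real (card (popular_sumset (1 / real K) Q (shift A n \<inter> {0..<int Q}) (int ` B)
                    - shift (A + B) n \<inter> {0..<int Q}))
        \<le> 1 / real K * real Q)"

text \<open>Markov's inequality with double counting: each \<open>i\<close> lies in at most
  \<open>a + b + 1\<close> windows. The condition \<open>a \<le> n\<close> keeps the truncated
  subtraction exact.\<close>

lemma card_window_sum_gt_le:
  fixes g :: "nat \<Rightarrow> real"
  assumes "finite I" "finite J" and g: "\<And>i. i \<in> J \<Longrightarrow> 0 \<le> g i"
    and IJ: "\<And>n. n \<in> I \<Longrightarrow> a \<le> n \<and> {n-a..n+b} \<subseteq> J"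
  shows "t * real (card {n \<in> I. t < (\<Sum>i=n-a..n+b. g i)}) \<le> real (a + b + 1) * (\<Sum>i\<in>J. g i)"
proof -
  define I' where "I' = {n \<in> I. t < (\<Sum>i=n-a..n+b. g i)}"
  have fin: "finite I'" using assms(1) by (simp add: I'_def)
  have "t * real (card I') \<le> (\<Sum>n\<in>I'. \<Sum>i=n-a..n+b. g i)"
    using sum_bounded_below[of I' t "\<lambda>n. \<Sum>i=n-a..n+b. g i"] by (auto simp: I'_def mult.commute less_imp_le)
  also have "\<dots> = (\<Sum>n\<in>I'. \<Sum>k=0..a+b. g (k + (n - a)))"
  proof (rule sum.cong[OF refl])
    fix n assume "n \<in> I'"
    then have "{n-a..n+b} = {0 + (n - a)..a + b + (n - a)}" using IJ by (auto simp: I'_def)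
    then show "(\<Sum>i=n-a..n+b. g i) = (\<Sum>k=0..a+b. g (k + (n - a)))"
      by (simp only: sum.shift_bounds_cl_nat_ivl)
  qed
  also have "\<dots> = (\<Sum>k=0..a+b. \<Sum>n\<in>I'. g (k + (n - a)))" by (rule sum.swap)
  also have "\<dots> \<le> (\<Sum>k=0..a+b. \<Sum>i\<in>J. g i)"
  proof (rule sum_mono)
    fix k assume k: "k \<in> {0..a+b}"
    have inj: "inj_on (\<lambda>n. k + (n - a)) I'"
    proof (rule inj_onI)
      fix x y assume "x \<in> I'" "y \<in> I'" "k + (x - a) = k + (y - a)"
      moreover from this have "a \<le> x" "a \<le> y" using IJ by (auto simp: I'_def)
      ultimately show "x = y" by simp
    qed
    have sub: "(\<lambda>n. k + (n - a)) ` I' \<subseteq> J"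
    proof clarify
      fix n assume "n \<in> I'"
      then have "a \<le> n" "{n-a..n+b} \<subseteq> J" using IJ by (auto simp: I'_def)
      moreover have "k + (n - a) \<in> {n-a..n+b}" using k \<open>a \<le> n\<close> by auto
      ultimately show "k + (n - a) \<in> J" by blast
    qed
    have "(\<Sum>n\<in>I'. g (k + (n - a))) = (\<Sum>i\<in>(\<lambda>n. k + (n - a)) ` I'. g i)"
      by (simp add: sum.reindex[OF inj])
    also have "\<dots> \<le> (\<Sum>i\<in>J. g i)" using sub g assms(2) by (intro sum_mono2) auto
    finally show "(\<Sum>n\<in>I'. g (k + (n - a))) \<le> (\<Sum>i\<in>J. g i)" .
  qed
  finally show ?thesis by (simp add: I'_def algebra_simps)
qed

text \<open>Four windows of length \<open>H\<close>, started \<open>H - 1\<close> apart, each share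
  one point with the next, so their constants agree. \<open>H \<ge> 5\<close> gives
  \<open>3 * H < 4 * (H - 1)\<close>, so they reach the whole range.\<close>

lemma constant_on_overlapping_windows:
  fixes f :: "nat \<Rightarrow> 'a"
  assumes H: "H \<ge> 5" and const: "\<And>j. j \<le> 3 \<Longrightarrow> (\<lambda>h. f (a + j * (H - 1) + h)) constant_on {1..H}"
  shows "\<exists>v. \<forall>m\<in>{a+1..a+3*H+1}. f m = v"
proof -
  have "\<forall>j\<in>{..3::nat}. \<exists>v. \<forall>h\<in>{1..H}. f (a + j * (H - 1) + h) = v"
    using const by (auto simp: constant_on_def)
  then obtain v where v: "\<And>j h. j \<le> 3 \<Longrightarrow> h \<in> {1..H} \<Longrightarrow> f (a + j * (H - 1) + h) = v j"
    using bchoice[of "{..3::nat}" "\<lambda>j v. \<forall>h\<in>{1..H}. f (a + j * (H - 1) + h) = v"] by auto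
  have step: "v (Suc j) = v j" if "Suc j \<le> 3" for j
  proof -
    have "a + Suc j * (H - 1) + 1 = a + j * (H - 1) + H" using H by simp
    then show ?thesis using v[of j H] v[of "Suc j" 1] that H
      by (metis Suc_leD atLeastAtMost_iff dual_order.refl le_trans one_le_numeral)
  qed
  have v0: "v j = v 0" if "j \<le> 3" for j using that by (induction j) (use step in auto)
  have "f m = v 0" if m: "m \<in> {a+1..a+3*H+1}" for m
  proof -
    define x where "x = m - a - 1"
    define j where "j = x div (H - 1)"
    have mx: "m = a + x + 1" using m by (simp add: x_def)
    have x3: "x < 4 * (H - 1)" using m H by (auto simp: x_def)
    have j: "j \<le> 3" using less_mult_imp_div_less[OF x3] by (simp add: j_def)
    have "m = a + j * (H - 1) + (x mod (H - 1) + 1)"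
      unfolding mx j_def using div_mult_mod_eq[of x "H - 1"] by simp
    moreover have "x mod (H - 1) + 1 \<in> {1..H}"
      using mod_less_divisor[of "H - 1" x] H unfolding atLeastAtMost_iff by linarith
    ultimately show ?thesis using v[OF j] v0[OF j] by metis
  qed
  then show ?thesis by blast
qed

text \<open>With frozen coefficients, translation by \<open>Q\<close> multiplies each term of the
  approximant by a factor close to 1. The approximation error passes from mean square to mean by
  \<open>D m \<le> (D m)\<^sup>2 / \<tau> + \<tau>\<close> and enters twice, at \<open>m\<close> and
  at \<open>m + Q\<close>.\<close>

lemma structured_shift_sum_le:
  fixes g :: "nat \<Rightarrow> real" and c :: "nat \<Rightarrow> nat \<Rightarrow> complex" and \<alpha> :: "nat \<Rightarrow> nat \<Rightarrow> real" and d :: nat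
  defines "D \<equiv> \<lambda>m. cmod ((\<Sum>i=1..d. c i m * e_circ (real m * \<alpha> i m)) - of_real (g m))"
  assumes Q: "H \<le> Q" "Q \<le> 2 * H" and n: "H < n"
    and c_const: "\<And>i m. i \<in> {1..d} \<Longrightarrow> m \<in> {n-H..n+2*H} \<Longrightarrow> c i m = c' i"
    and \<alpha>_const: "\<And>i m. i \<in> {1..d} \<Longrightarrow> m \<in> {n-H..n+2*H} \<Longrightarrow> \<alpha> i m = \<alpha>' i"
    and c1: "\<And>i. i \<in> {1..d} \<Longrightarrow> cmod (c' i) \<le> 1"
    and bohr: "\<And>i. i \<in> {1..d} \<Longrightarrow> norm_T (real Q * \<alpha>' i) \<le> e"
    and E: "(\<Sum>m=n-H..n+2*H. (D m)\<^sup>2) \<le> E" and \<tau>: "\<tau> > 0"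
  shows "(\<Sum>m=n-H..<n. \<bar>g (m + Q) - g m\<bar>) \<le> 2 * (E / \<tau> + \<tau> * (3 * real H + 1)) + real H * (real d * (2 * pi * e))"
proof -
  define G where "G m = (\<Sum>i=1..d. c i m * e_circ (real m * \<alpha> i m))" for m
  have D: "D m = cmod (G m - of_real (g m))" for m by (simp add: D_def G_def)
  have D0: "D m \<ge> 0" for m by (simp add: D)
  have DS: "(\<Sum>m=n-H..n+2*H. D m) \<le> E / \<tau> + \<tau> * (3 * real H + 1)"
  proof -
    have "D m \<le> (D m)\<^sup>2 / \<tau> + \<tau>" for m
    proof (cases "D m \<le> \<tau>")
      case True then show ?thesis using \<tau> by (simp add: add_increasing)
    next
      case False
      then have "\<tau> * D m \<le> D m * D m" using D0[of m] by (intro mult_right_mono) auto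
      then have "D m \<le> (D m)\<^sup>2 / \<tau>" using \<tau> by (simp add: le_divide_eq power2_eq_square mult.commute)
      then show ?thesis using \<tau> by simp
    qed
    then have "(\<Sum>m=n-H..n+2*H. D m) \<le> (\<Sum>m=n-H..n+2*H. (D m)\<^sup>2 / \<tau> + \<tau>)" by (intro sum_mono)
    also have "\<dots> = (\<Sum>m=n-H..n+2*H. (D m)\<^sup>2) / \<tau> + real (card {n-H..n+2*H}) * \<tau>"
      by (simp add: sum.distrib sum_divide_distrib)
    also have "real (card {n-H..n+2*H}) = 3 * real H + 1"
      using n by (simp add: of_nat_diff)
    also have "(\<Sum>m=n-H..n+2*H. (D m)\<^sup>2) / \<tau> \<le> E / \<tau>" using E \<tau> by (intro divide_right_mono) auto
    finally show ?thesis by (simp add: mult.commute)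
  qed
  have Gdiff: "cmod (G (m + Q) - G m) \<le> real d * (2 * pi * e)" if m: "m \<in> {n-H..<n}" for m
  proof -
    have mm: "m \<in> {n-H..n+2*H}" "m + Q \<in> {n-H..n+2*H}" using m Q by auto
    have "G (m + Q) - G m = (\<Sum>i=1..d. c' i * e_circ (real m * \<alpha>' i) * (e_circ (real Q * \<alpha>' i) - 1))"
      unfolding G_def sum_subtractf[symmetric]
      using mm by (intro sum.cong refl) (simp add: c_const \<alpha>_const e_circ_add algebra_simps)
    also have "cmod \<dots> \<le> (\<Sum>i=1..d. 2 * pi * e)"
    proof (intro sum_norm_le)
      fix i assume i: "i \<in> {1..d}"
      have "cmod (e_circ (real Q * \<alpha>' i) - 1) \<le> 2 * pi * norm_T (real Q * \<alpha>' i)"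
        by (rule norm_e_circ_minus_one_le)
      also have "\<dots> \<le> 2 * pi * e" using bohr[OF i] by simp
      finally have "cmod (c' i) * cmod (e_circ (real Q * \<alpha>' i) - 1) \<le> 1 * (2 * pi * e)"
        using c1[OF i] by (intro mult_mono) auto
      then show "cmod (c' i * e_circ (real m * \<alpha>' i) * (e_circ (real Q * \<alpha>' i) - 1)) \<le> 2 * pi * e"
        by (simp add: norm_mult)
    qed
    finally show ?thesis by simp
  qed
  have pt: "\<bar>g (m + Q) - g m\<bar> \<le> D (m + Q) + D m + real d * (2 * pi * e)" if m: "m \<in> {n-H..<n}" for m
  proof -
    have "complex_of_real (g (m + Q) - g m) =
       (G (m + Q) - G m) - (G (m + Q) - of_real (g (m + Q))) + (G m - of_real (g m))" by simp
    then have "\<bar>g (m + Q) - g m\<bar> = cmod ((G (m + Q) - G m) - (G (m + Q) - of_real (g (m + Q))) + (G m - of_real (g m)))"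
      by (metis norm_of_real)
    also have "\<dots> \<le> cmod (G (m + Q) - G m) + D (m + Q) + D m"
      unfolding D by (intro order_trans[OF norm_triangle_ineq] add_mono norm_triangle_ineq4 order_refl)
    finally show ?thesis using Gdiff[OF m] by simp
  qed
  have "(\<Sum>m=n-H..<n. \<bar>g (m + Q) - g m\<bar>) \<le> (\<Sum>m=n-H..<n. D (m + Q) + D m + real d * (2 * pi * e))"
    by (intro sum_mono pt)
  also have "\<dots> = (\<Sum>m=n-H..<n. D (m + Q)) + (\<Sum>m=n-H..<n. D m) + real H * (real d * (2 * pi * e))"
    using n by (simp add: sum.distrib)
  also have "(\<Sum>m=n-H..<n. D (m + Q)) = (\<Sum>m=n-H+Q..<n+Q. D m)"
    by (rule sum.shift_bounds_nat_ivl[symmetric])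
  also have "\<dots> \<le> (\<Sum>m=n-H..n+2*H. D m)" using Q D0 by (intro sum_mono2) auto
  also have "(\<Sum>m=n-H..<n. D m) \<le> (\<Sum>m=n-H..n+2*H. D m)" using D0 by (intro sum_mono2) auto
  finally show ?thesis using DS by simp
qed

text \<open>The structured part uses up at most half of \<open>\<delta> * Q\<close>, leaving at
  least the factor \<open>\<delta> * H / 2\<close> on the left. The right side is at most
  \<open>26 / 200 * \<delta>\<^sup>2 * H\<^sup>2\<close>, below
  \<open>(\<delta> * H / 2) * (\<delta> * H)\<close>, and division gives the bound.\<close>

lemma admissible_modulusI:
  fixes A :: "nat set" and g f :: "nat \<Rightarrow> real" and K :: nat
  defines "\<delta> \<equiv> 1 / real K"
  assumes K: "K \<ge> 1" and L: "1 \<le> L" "real L \<le> \<delta>\<^sup>2 / 200 * real H"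
    and H: "H \<ge> 1" and n: "H < n" and Q: "fact K dvd Q" "H \<le> Q" "real Q \<le> (1 + \<delta>) * real H"
    and decomp: "\<And>m. m \<ge> 1 \<Longrightarrow> indicator A m = g m + f m"
    and f: "\<And>m. m \<ge> 1 \<Longrightarrow> \<bar>f m\<bar> \<le> 1"
    and T: "(\<Sum>m=n-H..<n. \<bar>g (m + Q) - g m\<bar>) \<le> \<delta> / 2 * real H"
    and V: "(\<Sum>i=n-H-1..n+2*H. U2_interval i L (\<lambda>n. of_real (f n))) \<le> \<delta>\<^sup>2 / 200 * real H"
  shows "admissible_modulus A K H n Q"
proof -
  have \<delta>: "0 < \<delta>" "\<delta> \<le> 1" using K by (auto simp: \<delta>_def)
  have "(1 + \<delta>) * real H \<le> 2 * real H" using \<delta> by (intro mult_right_mono) auto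
  then have Q2: "Q \<le> 2 * H" using Q by linarith
  have "\<delta>\<^sup>2 \<le> 1" using \<delta> by (simp add: power_le_one)
  then have "\<delta>\<^sup>2 / 200 * real H \<le> 1 * real H" by (intro mult_right_mono) auto
  then have LH: "L \<le> H" using L by linarith
  have "real (card (popular_sumset \<delta> Q (shift A n \<inter> {0..<int Q}) (int ` B) - shift (A + B) n \<inter> {0..<int Q})) \<le> \<delta> * real Q"
    (is "real ?S \<le> _") if B: "B \<subseteq> {1..H}" for B
  proof -
    have Hpos: "real H > 0" using H by simp
    have "real ?S * (\<delta> * real Q - \<delta> / 2 * real H) \<le> 24 * real H * (\<delta>\<^sup>2 / 200 * real H) + 2 * real L * real H"
      by (rule card_popular_sumset_diff_le[OF L(1) LH Q(2) Q2 n B decomp f T V])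
    also have "\<dots> \<le> 24 * real H * (\<delta>\<^sup>2 / 200 * real H) + 2 * (\<delta>\<^sup>2 / 200 * real H) * real H"
      using L by (intro add_left_mono mult_right_mono mult_left_mono) auto
    also have "\<dots> \<le> (\<delta> * real H / 2) * (\<delta> * real H)"
      using Hpos \<delta> by (simp add: field_simps power2_eq_square)
    finally have 1: "real ?S * (\<delta> * real Q - \<delta> / 2 * real H) \<le> (\<delta> * real H / 2) * (\<delta> * real H)" .
    have "\<delta> * real H \<le> \<delta> * real Q" using \<delta> Q by simp
    then have "real ?S * (\<delta> * real H / 2) \<le> real ?S * (\<delta> * real Q - \<delta> / 2 * real H)"
      by (intro mult_left_mono) auto
    with 1 have "(\<delta> * real H / 2) * real ?S \<le> (\<delta> * real H / 2) * (\<delta> * real H)"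
      by (simp add: mult.commute)
    then have "real ?S \<le> \<delta> * real H" using \<delta> Hpos by simp
    then show ?thesis using \<open>\<delta> * real H \<le> \<delta> * real Q\<close> by linarith
  qed
  then show ?thesis unfolding admissible_modulus_def using Q by (simp add: \<delta>_def)
qed

text \<open>This turns a proportion of windows into an exceptional count relative to
  \<open>N s\<close>, the form in which exceptional sets are added up. As
  \<open>H s \<ge> 1\<close>, there are at most \<open>N s\<close> windows.\<close>

lemma for_most_windows_complement:
  assumes most: "for_most_windows N H P" and H: "\<And>s. s \<ge> 1 \<Longrightarrow> H s \<ge> (1::nat)"
  shows "(\<lambda>s. real (card {n \<in> {1..N s + 1 - H s}. \<not> P s n}) / real (N s)) \<longlonglongrightarrow> 0"
proof (rule Lim_null_comparison)
  define M where "M s = N s + 1 - H s" for s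
  define r where "r s = real (card {n \<in> {1..M s}. P s n}) / real (M s)" for s
  have r: "r \<longlonglongrightarrow> 1" using most unfolding for_most_windows_def r_def M_def .
  from tendsto_diff[OF tendsto_const[of 1] r] show "(\<lambda>s. 1 - r s) \<longlonglongrightarrow> 0" by simp
  have "eventually (\<lambda>s. r s > 0) sequentially" using order_tendstoD(1)[OF r] by simp
  then show "\<forall>\<^sub>F s in sequentially.
      norm (real (card {n \<in> {1..N s + 1 - H s}. \<not> P s n}) / real (N s)) \<le> 1 - r s"
    using eventually_ge_at_top[of 1]
  proof eventually_elim
    case (elim s)
    \<comment> \<open>Division by 0 yields 0, so \<open>r s > 0\<close> excludes an empty
      range.\<close>
    have M: "M s > 0" using elim by (auto simp: r_def intro!: Nat.gr0I)
    have MN: "M s \<le> N s" using H[OF elim(2)] by (simp add: M_def)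
    have "{n \<in> {1..M s}. \<not> P s n} = {1..M s} - {n \<in> {1..M s}. P s n}" by auto
    then have "card {n \<in> {1..M s}. \<not> P s n} = M s - card {n \<in> {1..M s}. P s n}"
      using card_Diff_subset[of "{n \<in> {1..M s}. P s n}" "{1..M s}"] by (simp only:) (simp add: subset_iff)
    moreover have "card {n \<in> {1..M s}. P s n} \<le> card {1..M s}" by (intro card_mono) auto
    ultimately have "real (card {n \<in> {1..M s}. \<not> P s n}) = real (M s) - real (card {n \<in> {1..M s}. P s n})"
      by (simp add: of_nat_diff)
    then have "real (card {n \<in> {1..M s}. \<not> P s n}) / real (M s) = 1 - r s"
      using M by (simp add: r_def diff_divide_distrib)
    moreover have "real (card {n \<in> {1..M s}. \<not> P s n}) / real (N s) \<le> real (card {n \<in> {1..M s}. \<not> P s n}) / real (M s)"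
      using M MN by (intro divide_left_mono) auto
    ultimately show ?case by (simp add: M_def)
  qed
qed

text \<open>An \<open>n\<close> can fail if it is near the ends of \<open>{1..N s}\<close>, if a
  coefficient or frequency changes nearby, if the gap condition fails at \<open>n\<close>, or if the
  local mean-square error or the local sum of uniformity norms is large. The mean-square error is
  granted half of the proportion \<open>1 / K\<close>; all other exceptions have proportion tending
  to 0.\<close>

lemma few_windows_without_admissible_modulus:
  fixes A :: "nat set" and N H :: "nat \<Rightarrow> nat"
  assumes N: "\<And>s. s \<ge> 1 \<Longrightarrow> N s \<ge> 1" and H: "\<And>s. s \<ge> 1 \<Longrightarrow> H s \<ge> 1"
    and Hinf: "filterlim H at_top sequentially" and HN: "H \<prec> N"
    and good: "U2_good_scale N H (indicator A)" and K: "K \<ge> 1"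
  shows "\<forall>\<^sub>F s in sequentially.
    real (card {n \<in> {1..N s}. \<nexists>Q. admissible_modulus A K (H s) n Q}) \<le> real (N s) / real K"
proof -
  define \<delta> where "\<delta> = 1 / real K"
  have \<delta>: "0 < \<delta>" "\<delta> \<le> 1" using K by (auto simp: \<delta>_def)
  obtain g f H' where decomp: "\<And>m. m \<ge> 1 \<Longrightarrow> indicator A m = g m + f m"
    and g01: "\<And>m. m \<ge> 1 \<Longrightarrow> g m \<in> {0..1}" and str: "U2_structured N H g"
    and H': "\<And>s. s \<ge> 1 \<Longrightarrow> H' s \<ge> 1" and H'H: "H' \<prec> H"
    and U2: "has_U2_norm N H' (\<lambda>n. of_real (f n)) 0"
    using good unfolding U2_good_scale_def by metis
  have f1: "\<bar>f m\<bar> \<le> 1" if "m \<ge> 1" for m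
    using decomp[OF that] g01[OF that] by (cases "m \<in> A") auto
  define v where "v = \<delta>\<^sup>2 / 200"
  \<comment> \<open>Chosen for \<open>\<tau> = \<delta> / 40\<close> below, where
    \<open>E / \<tau>\<close> becomes \<open>\<delta> / 20\<close>.\<close>
  define E where "E = \<delta>\<^sup>2 / 800"
  have v: "v > 0" and E: "E > 0" using \<delta> by (auto simp: v_def E_def)
  \<comment> \<open>This keeps the limiting mean square below \<open>E * \<delta> / 8\<close>;
    multiplied by the Markov factor \<open>4 / E\<close> it stays below
    \<open>\<delta> / 2\<close>.\<close>
  define \<epsilon> where "\<epsilon> = sqrt (E * \<delta> / 16)"
  have \<epsilon>: "\<epsilon> > 0" "\<epsilon>\<^sup>2 = E * \<delta> / 16" using E \<delta> by (auto simp: \<epsilon>_def)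
  obtain d :: nat and c :: "nat \<Rightarrow> nat \<Rightarrow> complex" and \<alpha> :: "nat \<Rightarrow> nat \<Rightarrow> real"
    where approx: "(\<forall>i\<in>{1..d}. \<forall>n\<ge>1. cmod (c i n) \<le> 1) \<and>
        (\<exists>r\<le>\<epsilon>. has_L2_norm N (\<lambda>n. (\<Sum>i=1..d. c i n * e_circ (real n * \<alpha> i n)) - of_real (g n)) r) \<and>
        (\<forall>C::real. C \<ge> 1 \<longrightarrow>
           for_most_windows N H (\<lambda>s n. \<forall>i\<in>{1..d}. (\<lambda>h. \<alpha> i (n + h)) constant_on {1..H s}) \<and>
           for_most_windows N H (\<lambda>s n. \<forall>i\<in>{1..d}. (\<lambda>h. c i (n + h)) constant_on {1..H s}) \<and>
           for_most_windows N H
             (\<lambda>s n. \<forall>w :: nat \<Rightarrow> int. (\<forall>i\<in>{1..d}. \<bar>real_of_int (w i)\<bar> \<le> C) \<longrightarrow>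
                norm_T (\<Sum>i=1..d. real_of_int (w i) * \<alpha> i n) \<le> 1 / (C * real (H s)) \<or>
                norm_T (\<Sum>i=1..d. real_of_int (w i) * \<alpha> i n) \<ge> C / real (H s)))"
    using str[unfolded U2_structured_def, rule_format, OF \<epsilon>(1)] by (elim exE) (rule that)
  note c1 = approx[THEN conjunct1] and L2 = approx[THEN conjunct2, THEN conjunct1]
    and windows = approx[THEN conjunct2, THEN conjunct2]
  obtain r where r: "r \<le> \<epsilon>" "has_L2_norm N (\<lambda>n. (\<Sum>i=1..d. c i n * e_circ (real n * \<alpha> i n)) - of_real (g n)) r"
    using L2 by blast
  \<comment> \<open>Since \<open>2 * pi < 8\<close>, the \<open>d\<close> frequencies together
    contribute at most \<open>\<delta> / 10\<close> per point.\<close>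
  define e where "e = \<delta> / (80 * (real d + 1))"
  have e: "e > 0" "e \<le> \<delta>" using \<delta> by (auto simp: e_def divide_simps mult_le_cancel_left1)
  obtain C H\<^sub>0 where C: "C \<ge> 1" and bohr: "\<And>h (\<beta> :: nat \<Rightarrow> real). h \<ge> H\<^sub>0 \<Longrightarrow>
    (\<forall>w :: nat \<Rightarrow> int. (\<forall>i\<in>{1..d}. \<bar>real_of_int (w i)\<bar> \<le> C) \<longrightarrow>
       norm_T (\<Sum>i=1..d. real_of_int (w i) * \<beta> i) \<le> 1 / (C * real h) \<or>
       norm_T (\<Sum>i=1..d. real_of_int (w i) * \<beta> i) \<ge> C / real h) \<Longrightarrow>
    (\<exists>Q. fact K dvd Q \<and> h \<le> Q \<and> real Q \<le> (1 + e) * real h \<and> (\<forall>i\<in>{1..d}. norm_T (real Q * \<beta> i) \<le> e))"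
    using exists_bohr_recurrence[OF e(1) fact_ge_1[of K], of d] by blast
  define P\<alpha> where "P\<alpha> s n \<longleftrightarrow> (\<forall>i\<in>{1..d}. (\<lambda>h. \<alpha> i (n + h)) constant_on {1..H s})" for s n
  define Pc where "Pc s n \<longleftrightarrow> (\<forall>i\<in>{1..d}. (\<lambda>h. c i (n + h)) constant_on {1..H s})" for s n
  define Pg where "Pg s n \<longleftrightarrow> (\<forall>w :: nat \<Rightarrow> int. (\<forall>i\<in>{1..d}. \<bar>real_of_int (w i)\<bar> \<le> C) \<longrightarrow>
                norm_T (\<Sum>i=1..d. real_of_int (w i) * \<alpha> i n) \<le> 1 / (C * real (H s)) \<or>
                norm_T (\<Sum>i=1..d. real_of_int (w i) * \<alpha> i n) \<ge> C / real (H s))" for s n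
  define D where "D m = cmod ((\<Sum>i=1..d. c i m * e_circ (real m * \<alpha> i m)) - of_real (g m))" for m
  define U where "U s i = U2_interval i (H' s) (\<lambda>n. of_real (f n))" for s i
  define bad where "bad P s = {a \<in> {1..N s + 1 - H s}. \<not> P s a}" for P :: "nat \<Rightarrow> nat \<Rightarrow> bool" and s
  note most = windows[rule_format, OF C]
  have lim\<alpha>: "(\<lambda>s. real (card (bad P\<alpha> s)) / real (N s)) \<longlonglongrightarrow> 0"
    unfolding bad_def P\<alpha>_def by (rule for_most_windows_complement[OF most[THEN conjunct1] H])
  have limc: "(\<lambda>s. real (card (bad Pc s)) / real (N s)) \<longlonglongrightarrow> 0"
    unfolding bad_def Pc_def by (rule for_most_windows_complement[OF most[THEN conjunct2, THEN conjunct1] H])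
  have limg: "(\<lambda>s. real (card (bad Pg s)) / real (N s)) \<longlonglongrightarrow> 0"
    unfolding bad_def Pg_def by (rule for_most_windows_complement[OF most[THEN conjunct2, THEN conjunct2] H])
  have limH: "(\<lambda>s. real (H s) / real (N s)) \<longlonglongrightarrow> 0" using HN by (simp add: seq_prec_def)
  have Hev: "\<forall>\<^sub>F s in sequentially. H s \<ge> max 5 H\<^sub>0"
    using Hinf unfolding filterlim_at_top by blast
  have "\<forall>\<^sub>F s in sequentially. real (H s) / real (N s) < 1 / 10"
    by (rule order_tendstoD(2)[OF limH]) simp
  then have HNev: "\<forall>\<^sub>F s in sequentially. 10 * H s \<le> N s"
    using eventually_ge_at_top[of 1]
  proof eventually_elim
    case (elim s)
    have "real (N s) > 0" using N[OF elim(2)] by simp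
    then have "10 * real (H s) \<le> real (N s)" using elim(1) by (simp add: field_simps)
    then show ?case by linarith
  qed
  have "\<forall>\<^sub>F s in sequentially. real (H' s) / real (H s) < v"
    using H'H v unfolding seq_prec_def by (rule order_tendstoD(2))
  then have H'ev: "\<forall>\<^sub>F s in sequentially. real (H' s) \<le> v * real (H s)"
    using eventually_ge_at_top[of 1]
  proof eventually_elim
    case (elim s)
    then show ?case using H[OF elim(2)] by (simp add: field_simps)
  qed
  have v1: "v \<le> 1" using \<delta> power_le_one[of \<delta> 2] by (simp add: v_def)
  \<comment> \<open>\<open>has_U2_norm\<close> numbers windows from 1, \<open>U\<close> by their
    offset from 0; dividing by the larger \<open>N s\<close> only lowers the average.\<close>
  have limU: "(\<lambda>s. (\<Sum>i=0..N s - H' s. U s i) / real (N s)) \<longlonglongrightarrow> 0"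
  proof (rule Lim_null_comparison)
    show "(\<lambda>s. (\<Sum>n=1..N s + 1 - H' s. U2_interval (n - 1) (H' s) (\<lambda>n. of_real (f n))) / real (N s + 1 - H' s)) \<longlonglongrightarrow> 0"
      using U2 by (simp add: has_U2_norm_def)
    show "\<forall>\<^sub>F s in sequentially. norm ((\<Sum>i=0..N s - H' s. U s i) / real (N s))
        \<le> (\<Sum>n=1..N s + 1 - H' s. U2_interval (n - 1) (H' s) (\<lambda>n. of_real (f n))) / real (N s + 1 - H' s)"
      using H'ev HNev eventually_ge_at_top[of 1]
    proof eventually_elim
      case (elim s)
      have "v * real (H s) \<le> 1 * real (H s)" using v1 by (intro mult_right_mono) auto
      then have le: "H' s \<le> N s" using elim by linarith
      have "(\<Sum>n=1..N s + 1 - H' s. U2_interval (n - 1) (H' s) (\<lambda>n. of_real (f n))) = (\<Sum>i=0..N s - H' s. U s i)"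
        using le by (intro sum.reindex_bij_witness[of _ "\<lambda>i. i + 1" "\<lambda>n. n - 1"]) (auto simp: U_def)
      moreover have "0 \<le> (\<Sum>i=0..N s - H' s. U s i)" by (intro sum_nonneg) (simp add: U_def U2_interval_nonneg)
      moreover have "0 < real (N s + 1 - H' s)" "real (N s + 1 - H' s) \<le> real (N s)"
        using le H'[OF elim(3)] by auto
      ultimately show ?case by (auto intro!: divide_left_mono mult_pos_pos)
    qed
  qed
  obtain l where l: "(\<lambda>s. (\<Sum>m=1..N s. (D m)\<^sup>2) / real (N s)) \<longlonglongrightarrow> l" "r = sqrt l"
    using r(2) by (auto simp: has_L2_norm_def has_avg_def D_def)
  have "l \<le> \<epsilon>\<^sup>2" using r(1) \<epsilon>(1) l(2) by (metis real_le_rsqrt real_sqrt_le_iff real_sqrt_unique less_imp_le)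
  then have "l < E * \<delta> / 8" using \<epsilon>(2) mult_pos_pos[OF E \<delta>(1)] by linarith
  then have Dev: "\<forall>\<^sub>F s in sequentially. (\<Sum>m=1..N s. (D m)\<^sup>2) / real (N s) < E * \<delta> / 8"
    by (rule order_tendstoD(2)[OF l(1)])
  \<comment> \<open>The weights are the multiplicities that \<open>cI\<close>, \<open>cX\<close> and
    \<open>cV\<close> establish below.\<close>
  have "(\<lambda>s. 8 * (real (H s) / real (N s)) + 4 * (real (card (bad P\<alpha> s)) / real (N s))
      + 4 * (real (card (bad Pc s)) / real (N s)) + real (card (bad Pg s)) / real (N s)
      + 5 / v * ((\<Sum>i=0..N s - H' s. U s i) / real (N s))) \<longlonglongrightarrow> 8 * 0 + 4 * 0 + 4 * 0 + 0 + 5 / v * 0"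
    by (intro tendsto_intros limH lim\<alpha> limc limg limU)
  then have small: "\<forall>\<^sub>F s in sequentially. 8 * (real (H s) / real (N s)) + 4 * (real (card (bad P\<alpha> s)) / real (N s))
      + 4 * (real (card (bad Pc s)) / real (N s)) + real (card (bad Pg s)) / real (N s)
      + 5 / v * ((\<Sum>i=0..N s - H' s. U s i) / real (N s)) < \<delta> / 2"
    by (rule order_tendstoD) (use \<delta> in simp)
  show ?thesis
    using small Dev H'ev HNev Hev eventually_ge_at_top[of 1]
  proof eventually_elim
    case (elim s)
    have Hs: "H s \<ge> 5" "H s \<ge> H\<^sub>0" "10 * H s \<le> N s" using elim by auto
    \<comment> \<open>The margins keep every window used around \<open>n\<close> inside
      \<open>{1..N s}\<close>.\<close>
    define I where "I = {2 * H s + 2..N s - 5 * H s}"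
    \<comment> \<open>Four overlapping windows cover \<open>{n - H s..n + 2 * H s}\<close>, hence
      the union over \<open>j \<le> 3\<close>.\<close>
    define X where "X P = (\<Union>j\<in>{..3}. {n \<in> I. n - H s - 1 + j * (H s - 1) \<in> bad P s})" for P
    define XV where "XV = {n \<in> I. v * real (H s) < (\<Sum>i=n-(H s + 1)..n+2*H s. U s i)}"
    define XD where "XD = {n \<in> I. E * real (H s) < (\<Sum>m=n-H s..n+2*H s. (D m)\<^sup>2)}"
    have "v * real (H s) \<le> 1 * real (H s)" using v1 by (intro mult_right_mono) auto
    then have H'le: "H' s \<le> H s" using elim by linarith
    have cover: "{n \<in> {1..N s}. \<nexists>Q. admissible_modulus A K (H s) n Q}
      \<subseteq> ({1..N s} - I) \<union> X P\<alpha> \<union> X Pc \<union> bad Pg s \<union> XV \<union> XD"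
    proof (rule subsetI, rule ccontr)
      fix n assume n: "n \<in> {n \<in> {1..N s}. \<nexists>Q. admissible_modulus A K (H s) n Q}"
        and nX: "n \<notin> ({1..N s} - I) \<union> X P\<alpha> \<union> X Pc \<union> bad Pg s \<union> XV \<union> XD"
      have nI: "n \<in> I" using n nX by auto
      then have n2: "2 * H s + 2 \<le> n" "n + 5 * H s \<le> N s" using Hs by (auto simp: I_def)
      define a where "a = n - H s - 1"
      have range: "{a+1..a+3*H s+1} = {n-H s..n+2*H s}" using n2 by (auto simp: a_def)
      have win: "P s (a + j * (H s - 1))" if "j \<le> 3" "n \<notin> X P" for P and j :: nat
      proof -
        have "j * (H s - 1) \<le> 3 * H s" using that by (intro mult_mono) auto
        then have "a + j * (H s - 1) \<in> {1..N s + 1 - H s}"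
          using n2 Hs unfolding a_def atLeastAtMost_iff by linarith
        moreover have "a + j * (H s - 1) \<notin> bad P s" using that nI by (auto simp: X_def a_def)
        ultimately show ?thesis by (auto simp: bad_def)
      qed
      have "\<exists>w. \<forall>m\<in>{n-H s..n+2*H s}. \<alpha> i m = w" if "i \<in> {1..d}" for i
        unfolding range[symmetric] using win[of _ P\<alpha>] nX that
        by (intro constant_on_overlapping_windows[OF Hs(1)]) (auto simp: P\<alpha>_def)
      then obtain \<alpha>' where \<alpha>': "\<And>i m. i \<in> {1..d} \<Longrightarrow> m \<in> {n-H s..n+2*H s} \<Longrightarrow> \<alpha> i m = \<alpha>' i"
        by metis
      have "\<exists>w. \<forall>m\<in>{n-H s..n+2*H s}. c i m = w" if "i \<in> {1..d}" for i
        unfolding range[symmetric] using win[of _ Pc] nX that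
        by (intro constant_on_overlapping_windows[OF Hs(1)]) (auto simp: Pc_def)
      then obtain c' where c': "\<And>i m. i \<in> {1..d} \<Longrightarrow> m \<in> {n-H s..n+2*H s} \<Longrightarrow> c i m = c' i"
        by metis
      have nn: "n \<in> {n-H s..n+2*H s}" by simp
      have c'1: "cmod (c' i) \<le> 1" if "i \<in> {1..d}" for i
        using c1 that c'[OF that nn] n2 by (metis add_leD2 one_le_numeral order_trans)
      \<comment> \<open>The frequencies are constant around \<open>n\<close>, so the gap condition
        at the single point \<open>n\<close> controls the whole window.\<close>
      have "Pg s n" using nX n2 Hs by (auto simp: bad_def)
      then obtain Q where Q: "fact K dvd Q" "H s \<le> Q" "real Q \<le> (1 + e) * real (H s)"
        "\<And>i. i \<in> {1..d} \<Longrightarrow> norm_T (real Q * \<alpha> i n) \<le> e"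
        using bohr[OF Hs(2), of "\<lambda>i. \<alpha> i n"] unfolding Pg_def by blast
      have "(1 + e) * real (H s) \<le> (1 + \<delta>) * real (H s)" using e by (intro mult_right_mono) auto
      then have Q\<delta>: "real Q \<le> (1 + \<delta>) * real (H s)" using Q by linarith
      have "(1 + \<delta>) * real (H s) \<le> 2 * real (H s)" using \<delta> by (intro mult_right_mono) auto
      then have Q2: "Q \<le> 2 * H s" using Q\<delta> by linarith
      have nH: "H s < n" using n2 by simp
      have "(\<Sum>m=n-H s..<n. \<bar>g (m + Q) - g m\<bar>) \<le>
         2 * (E * real (H s) / (\<delta> / 40) + \<delta> / 40 * (3 * real (H s) + 1)) + real (H s) * (real d * (2 * pi * e))"
      proof (rule structured_shift_sum_le[OF Q(2) Q2 nH c' \<alpha>' c'1])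
        show "norm_T (real Q * \<alpha>' i) \<le> e" if "i \<in> {1..d}" for i
          using Q(4)[OF that] \<alpha>'[OF that nn] by simp
        show "(\<Sum>m=n-H s..n+2*H s. (cmod ((\<Sum>i=1..d. c i m * e_circ (real m * \<alpha> i m)) - of_real (g m)))\<^sup>2)
            \<le> E * real (H s)"
          using nX nI by (auto simp: XD_def D_def)
      qed (use \<delta> in auto)
      also have "\<dots> \<le> \<delta> / 2 * real (H s)"
      proof -
        have a1: "E * real (H s) / (\<delta> / 40) = \<delta> / 20 * real (H s)"
          using \<delta> by (simp add: E_def field_simps power2_eq_square)
        have a2: "\<delta> / 40 * (3 * real (H s) + 1) \<le> \<delta> / 40 * (4 * real (H s))"
          using \<delta> Hs by (intro mult_left_mono) auto
        have "real d * (2 * pi * e) \<le> \<delta> / 10"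
        proof -
          have "real d * e \<le> \<delta> / 80" using \<delta> by (simp add: e_def divide_simps)
          then have "2 * pi * (real d * e) \<le> 8 * (\<delta> / 80)"
            using pi_less_4 e by (intro mult_mono) auto
          then show ?thesis by (simp add: mult_ac)
        qed
        then have a3: "real (H s) * (real d * (2 * pi * e)) \<le> real (H s) * (\<delta> / 10)" by (intro mult_left_mono) auto
        have "2 * (E * real (H s) / (\<delta> / 40) + \<delta> / 40 * (3 * real (H s) + 1)) + real (H s) * (real d * (2 * pi * e))
           \<le> 2 * (\<delta> / 20 * real (H s) + \<delta> / 40 * (4 * real (H s))) + real (H s) * (\<delta> / 10)"
          unfolding a1 by (rule add_mono[OF mult_left_mono[OF add_left_mono[OF a2]] a3]) simp
        also have "\<dots> = 2 / 5 * (\<delta> * real (H s))" by simp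
        also have "\<dots> \<le> 1 / 2 * (\<delta> * real (H s))" using \<delta> by (intro mult_right_mono) auto
        finally show ?thesis by simp
      qed
      finally have T: "(\<Sum>m=n-H s..<n. \<bar>g (m + Q) - g m\<bar>) \<le> \<delta> / 2 * real (H s)" .
      have V: "(\<Sum>i=n-H s-1..n+2*H s. U2_interval i (H' s) (\<lambda>n. of_real (f n))) \<le> \<delta>\<^sup>2 / 200 * real (H s)"
        using nX nI by (auto simp: XV_def U_def v_def)
      have "admissible_modulus A K (H s) n Q"
        using H'[OF elim(6)] elim(3) Hs Q\<delta>
        by (intro admissible_modulusI[OF K, where L = "H' s" and g = g and f = f] nH Q decomp f1 T[unfolded \<delta>_def] V[unfolded \<delta>_def])
           (auto simp: \<delta>_def v_def)
      then show False using n by blast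
    qed
    have finbad: "finite (bad P s)" for P by (simp add: bad_def)
    \<comment> \<open>For each of the four values of \<open>j\<close>, a bad window comes from at
      most one \<open>n\<close>.\<close>
    have cX: "card (X P) \<le> 4 * card (bad P s)" for P
    proof -
      have "card (X P) \<le> (\<Sum>j\<in>{..3}. card {n \<in> I. n - H s - 1 + j * (H s - 1) \<in> bad P s})"
        unfolding X_def by (rule card_UN_le) simp
      also have "\<dots> \<le> (\<Sum>j\<in>{..3::nat}. card (bad P s))"
      proof (rule sum_mono)
        fix j :: nat
        have "inj_on (\<lambda>n. n - H s - 1 + j * (H s - 1)) {n \<in> I. n - H s - 1 + j * (H s - 1) \<in> bad P s}"
          by (rule inj_onI) (auto simp: I_def)
        then show "card {n \<in> I. n - H s - 1 + j * (H s - 1) \<in> bad P s} \<le> card (bad P s)"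
          by (rule card_inj_on_le) (auto simp: finbad)
      qed
      finally show ?thesis by simp
    qed
    have cI: "card ({1..N s} - I) \<le> 8 * H s"
    proof -
      have "{1..N s} - I \<subseteq> {1..2 * H s + 1} \<union> {N s - 5 * H s + 1..N s}" by (auto simp: I_def)
      then have "card ({1..N s} - I) \<le> card ({1..2 * H s + 1} \<union> {N s - 5 * H s + 1..N s})"
        by (intro card_mono) auto
      also have "\<dots> \<le> card {1..2 * H s + 1} + card {N s - 5 * H s + 1..N s}" by (rule card_Un_le)
      also have "\<dots> \<le> 8 * H s" using Hs by simp
      finally show ?thesis .
    qed
    have cV: "real (card XV) \<le> 5 / v * (\<Sum>i=0..N s - H' s. U s i)"
    proof -
      have U0: "0 \<le> (\<Sum>i=0..N s - H' s. U s i)" by (intro sum_nonneg) (simp add: U_def U2_interval_nonneg)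
      have "(v * real (H s)) * real (card XV) \<le> real (H s + 1 + 2 * H s + 1) * (\<Sum>i=0..N s - H' s. U s i)"
        unfolding XV_def
        by (rule card_window_sum_gt_le) (use Hs H'le in \<open>auto simp: I_def U_def U2_interval_nonneg\<close>)
      also have "\<dots> \<le> (5 * real (H s)) * (\<Sum>i=0..N s - H' s. U s i)"
        using Hs U0 by (intro mult_right_mono) auto
      finally have "real (H s) * (v * real (card XV)) \<le> real (H s) * (5 * (\<Sum>i=0..N s - H' s. U s i))"
        by (simp add: mult_ac)
      then have "v * real (card XV) \<le> 5 * (\<Sum>i=0..N s - H' s. U s i)" using Hs by simp
      then show ?thesis using v by (simp add: field_simps)
    qed
    have cD: "real (card XD) \<le> 4 / E * (\<Sum>m=1..N s. (D m)\<^sup>2)"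
    proof -
      have D0: "0 \<le> (\<Sum>m=1..N s. (D m)\<^sup>2)" by (intro sum_nonneg) simp
      have "(E * real (H s)) * real (card XD) \<le> real (H s + 2 * H s + 1) * (\<Sum>m=1..N s. (D m)\<^sup>2)"
        unfolding XD_def
        by (rule card_window_sum_gt_le) (use Hs in \<open>auto simp: I_def\<close>)
      also have "\<dots> \<le> (4 * real (H s)) * (\<Sum>m=1..N s. (D m)\<^sup>2)"
        using Hs D0 by (intro mult_right_mono) auto
      finally have "real (H s) * (E * real (card XD)) \<le> real (H s) * (4 * (\<Sum>m=1..N s. (D m)\<^sup>2))"
        by (simp add: mult_ac)
      then have "E * real (card XD) \<le> 4 * (\<Sum>m=1..N s. (D m)\<^sup>2)" using Hs by simp
      then show ?thesis using E by (simp add: field_simps)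
    qed
    have Npos: "real (N s) > 0" using N[OF elim(6)] by simp
    have finX: "finite (X P)" "finite XV" "finite XD" for P by (auto simp: X_def XV_def XD_def I_def)
    have "card {n \<in> {1..N s}. \<nexists>Q. admissible_modulus A K (H s) n Q}
       \<le> card (({1..N s} - I) \<union> X P\<alpha> \<union> X Pc \<union> bad Pg s \<union> XV \<union> XD)"
      by (intro card_mono cover) (auto simp: finX finbad)
    also have "\<dots> \<le> card ({1..N s} - I) + card (X P\<alpha>) + card (X Pc) + card (bad Pg s) + card XV + card XD"
      by (intro order_trans[OF card_Un_le] add_mono order_refl)
    also have "\<dots> \<le> 8 * H s + 4 * card (bad P\<alpha> s) + 4 * card (bad Pc s) + card (bad Pg s) + card XV + card XD"
      by (intro add_mono cI cX order_refl)
    finally have "real (card {n \<in> {1..N s}. \<nexists>Q. admissible_modulus A K (H s) n Q})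
      \<le> real (8 * H s + 4 * card (bad P\<alpha> s) + 4 * card (bad Pc s) + card (bad Pg s) + card XV + card XD)"
      by (simp only: of_nat_le_iff)
    also have "\<dots> \<le> 8 * real (H s) + 4 * real (card (bad P\<alpha> s)) + 4 * real (card (bad Pc s)) + real (card (bad Pg s))
        + 5 / v * (\<Sum>i=0..N s - H' s. U s i) + 4 / E * (\<Sum>m=1..N s. (D m)\<^sup>2)"
      using cV cD by simp
    also have "\<dots> = real (N s) * (8 * (real (H s) / real (N s)) + 4 * (real (card (bad P\<alpha> s)) / real (N s))
      + 4 * (real (card (bad Pc s)) / real (N s)) + real (card (bad Pg s)) / real (N s)
      + 5 / v * ((\<Sum>i=0..N s - H' s. U s i) / real (N s)) + 4 / E * ((\<Sum>m=1..N s. (D m)\<^sup>2) / real (N s)))"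
      using Npos by (simp add: distrib_left)
    \<comment> \<open>\<open>small\<close> bounds all terms but the last, which \<open>Dev\<close>
      bounds; the two halves add up to \<open>\<delta> = 1 / K\<close>.\<close>
    also have "\<dots> \<le> real (N s) * (\<delta> / 2 + 4 / E * (E * \<delta> / 8))"
      using elim(1,2) E by (intro mult_left_mono add_mono) auto
    also have "\<dots> = real (N s) / real K" using E by (simp add: \<delta>_def)
    finally show ?case .
  qed
qed

subsection \<open>Diagonalisation\<close>

text \<open>\<open>\<kappa> s\<close> is the largest \<open>K \<le> s\<close> whose threshold
  \<open>s\<close> has passed. The inserted 0 keeps the maximum defined before any threshold is
  passed, whence the condition \<open>\<kappa> s \<ge> 1\<close>.\<close>

lemma diagonal_choice:
  fixes Good :: "nat \<Rightarrow> nat \<Rightarrow> bool"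
  assumes "\<And>K. K \<ge> 1 \<Longrightarrow> \<forall>\<^sub>F s in sequentially. Good K s"
  obtains \<kappa> :: "nat \<Rightarrow> nat" where "filterlim \<kappa> at_top sequentially" "\<And>s. \<kappa> s \<ge> 1 \<Longrightarrow> Good (\<kappa> s) s"
proof -
  have "\<forall>K. \<exists>s0. K \<ge> 1 \<longrightarrow> (\<forall>s\<ge>s0. Good K s)"
    using assms unfolding eventually_sequentially by blast
  then obtain s0 where s0: "\<And>K s. K \<ge> 1 \<Longrightarrow> s \<ge> s0 K \<Longrightarrow> Good K s" by metis
  define S where "S s = insert 0 {K \<in> {1..s}. s0 K \<le> s}" for s
  define \<kappa> where "\<kappa> s = Max (S s)" for s
  have fin: "finite (S s)" for s by (simp add: S_def)
  have mem: "\<kappa> s \<in> S s" for s unfolding \<kappa>_def by (rule Max_in[OF fin]) (simp add: S_def)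
  show ?thesis
  proof
    show "filterlim \<kappa> at_top sequentially"
      unfolding filterlim_at_top eventually_sequentially
    proof
      fix Z
      have "Z \<le> \<kappa> s" if "s \<ge> max Z (s0 Z)" for s
        unfolding \<kappa>_def by (rule Max_ge[OF fin]) (use that in \<open>auto simp: S_def\<close>)
      then show "\<exists>N. \<forall>s\<ge>N. Z \<le> \<kappa> s" by blast
    qed
    show "Good (\<kappa> s) s" if "\<kappa> s \<ge> 1" for s
      using mem[of s] that s0[OF that, of s] by (auto simp: S_def)
  qed
qed

text \<open>\<open>Q \<ge> 1\<close> makes \<open>Suc Q\<close> a nondivisor, so a least one exists;
  every positive \<open>m\<close> up to \<open>K\<close> divides \<open>fact K\<close> and hence
  \<open>Q\<close>.\<close>

lemma less_least_nondivisor: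
  assumes "fact K dvd Q" "Q \<ge> 1"
  shows "K < least_nondivisor Q"
proof -
  have "\<not> Suc Q dvd Q" using assms by (auto dest: dvd_imp_le)
  then have "1 \<le> least_nondivisor Q \<and> \<not> least_nondivisor Q dvd Q"
    unfolding least_nondivisor_def by (intro LeastI[of "\<lambda>m. m \<ge> 1 \<and> \<not> m dvd Q" "Suc Q"]) auto
  moreover have "m dvd Q" if "1 \<le> m" "m \<le> K" for m
    using that assms dvd_fact[of m K] dvd_trans by blast
  ultimately show ?thesis by (meson not_le)
qed

text \<open>Both error sequences are \<open>1 / \<kappa> s\<close> with \<open>\<kappa>\<close> from
  the diagonal choice. \<open>G\<close> collects the \<open>n\<close> for which a modulus is
  available, and the limit of the least nondivisor is taken along \<open>G\<close>.\<close>

theorem theorem9p9: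
  fixes A :: "nat set" and d :: real and N H :: "nat \<Rightarrow> nat"
  assumes "has_density A d" and "d > 0"
    and "N 0 = 0" and "\<And>s. s \<ge> 1 \<Longrightarrow> N s \<ge> 1" and "\<And>s. s \<ge> 1 \<Longrightarrow> H s \<ge> 1"
    and "filterlim H at_top sequentially" and "H \<prec> N"
    and "(\<lambda>s. real (N s) / real (N (Suc s))) \<longlonglongrightarrow> 0"
    and "U2_good_scale N H (indicator A)"
  shows "\<exists>(\<epsilon> :: nat \<Rightarrow> real) (\<delta> :: nat \<Rightarrow> real) (G :: nat set) (Q :: nat \<Rightarrow> nat).
    \<epsilon> \<longlonglongrightarrow> 0 \<and> \<delta> \<longlonglongrightarrow> 0 \<and>
    (\<lambda>s. real (card ({N (s - 1) + 1..N s} - G)) / real (N s)) \<longlonglongrightarrow> 0 \<and>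
    (\<forall>s\<ge>1. \<forall>n \<in> {N (s - 1) + 1..N s} \<inter> G.
       real (H s) \<le> real (Q n) \<and> real (Q n) \<le> (1 + \<epsilon> s) * real (H s) \<and>
       (\<forall>B \<subseteq> {1..H s}.
          real (card (popular_sumset (\<delta> s) (Q n) (shift A n \<inter> {0..<int (Q n)}) (int ` B)
                      - shift (A + B) n \<inter> {0..<int (Q n)}))
          \<le> \<epsilon> s * real (Q n))) \<and>
    filterlim (\<lambda>n. least_nondivisor (Q n)) at_top (inf sequentially (principal G))"
proof -
  note Npos = assms(4) and Hpos = assms(5)
  have ev: "\<forall>\<^sub>F s in sequentially.
      real (card {n \<in> {1..N s}. \<nexists>Q. admissible_modulus A K (H s) n Q}) \<le> real (N s) / real K" if "K \<ge> 1" for K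
    using few_windows_without_admissible_modulus[OF Npos Hpos assms(6,7,9) that] by simp
  obtain \<kappa> where \<kappa>: "filterlim \<kappa> at_top sequentially"
    and few: "\<And>s. \<kappa> s \<ge> 1 \<Longrightarrow>
      real (card {n \<in> {1..N s}. \<nexists>Q. admissible_modulus A (\<kappa> s) (H s) n Q}) \<le> real (N s) / real (\<kappa> s)"
    by (rule diagonal_choice[of "\<lambda>K s. real (card {n \<in> {1..N s}. \<nexists>Q. admissible_modulus A K (H s) n Q}) \<le> real (N s) / real K"])
       (rule ev, assumption, rule that)
  have \<kappa>0: "(\<lambda>s. 1 / real (\<kappa> s)) \<longlonglongrightarrow> 0"
    using \<kappa> by (intro tendsto_divide_0[OF tendsto_const] filterlim_at_top_imp_at_infinity
        filterlim_compose[OF filterlim_real_sequentially])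
  have "\<forall>\<^sub>F s in sequentially. real (N s) / real (N (Suc s)) < 1"
    using order_tendstoD(2)[OF assms(8)] by simp
  then obtain s1 where s1: "\<And>s. s \<ge> s1 \<Longrightarrow> N s < N (Suc s)"
  proof -
    assume *: "\<And>s1. (\<And>s. s1 \<le> s \<Longrightarrow> N s < N (Suc s)) \<Longrightarrow> thesis"
    from \<open>eventually _ _\<close> obtain s1 where lt1: "\<And>s. s \<ge> s1 \<Longrightarrow> real (N s) / real (N (Suc s)) < 1"
      unfolding eventually_sequentially by blast
    have "N s < N (Suc s)" if "s \<ge> s1" for s
    proof -
      have "real (N (Suc s)) > 0" using Npos[of "Suc s"] by simp
      moreover have "real (N s) / real (N (Suc s)) < 1" using lt1 that by blast
      ultimately show ?thesis by (simp add: divide_less_eq)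
    qed
    then show thesis by (rule *)
  qed
  have mono: "N s \<le> N t" if "s1 \<le> s" "s \<le> t" for s t
    using that(2)
  proof (induction rule: dec_induct)
    case (step t)
    then show ?case using s1[of t] that(1) by linarith
  qed simp
  have Ninf: "filterlim N at_top sequentially"
    unfolding filterlim_at_top eventually_sequentially
  proof
    fix Z
    have grow: "k \<le> N (s1 + k)" for k
    proof (induction k)
      case (Suc k) then show ?case using s1[of "s1 + k"] by simp
    qed simp
    have "Z \<le> N s" if "s \<ge> s1 + Z" for s
      using grow[of "s - s1"] that by simp
    then show "\<exists>k. \<forall>s\<ge>k. Z \<le> N s" by blast
  qed
  \<comment> \<open>\<open>N\<close> is known to increase from \<open>s1\<close> on. Beyond
    \<open>Nmax\<close> the blocks are disjoint, so \<open>n\<close> determines its block.\<close>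
  define Nmax where "Nmax = Max (N ` {..s1})"
  define block where "block s = {N (s - 1) + 1..N s}" for s
  have late: "s > s1" if "n \<in> block s" "n > Nmax" for n s
  proof (rule ccontr)
    assume "\<not> s > s1"
    then have "N s \<le> Nmax" unfolding Nmax_def by (intro Max_ge) auto
    then show False using that by (simp add: block_def)
  qed
  have uniq: "s = t" if "n \<in> block s" "n \<in> block t" "n > Nmax" for n s t
  proof -
    have "\<not> s < t" if "n \<in> block s" "n \<in> block t" "n > Nmax" for s t
    proof
      assume "s < t"
      then have "N s \<le> N (t - 1)" using late[OF that(1,3)] by (intro mono) auto
      then show False using that by (auto simp: block_def)
    qed
    then show ?thesis using that by (meson linorder_neqE_nat)
  qed
  define G where "G = {n. n > Nmax \<and> (\<exists>s. n \<in> block s \<and> \<kappa> s \<ge> 1 \<and> (\<exists>Q. admissible_modulus A (\<kappa> s) (H s) n Q))}"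
  \<comment> \<open>By uniqueness of the block index, \<open>Q\<close> can be chosen as a function
    of \<open>n\<close> alone.\<close>
  have "\<forall>n. \<exists>Q. \<forall>s. n \<in> G \<longrightarrow> n \<in> block s \<longrightarrow> \<kappa> s \<ge> 1 \<and> admissible_modulus A (\<kappa> s) (H s) n Q"
  proof
    fix n
    show "\<exists>Q. \<forall>s. n \<in> G \<longrightarrow> n \<in> block s \<longrightarrow> \<kappa> s \<ge> 1 \<and> admissible_modulus A (\<kappa> s) (H s) n Q"
      unfolding G_def using uniq by blast
  qed
  then obtain Q where Q: "\<And>n s. n \<in> G \<Longrightarrow> n \<in> block s \<Longrightarrow> \<kappa> s \<ge> 1 \<and> admissible_modulus A (\<kappa> s) (H s) n (Q n)"
    by metis
  have "(\<lambda>s. real (card (block s - G)) / real (N s)) \<longlonglongrightarrow> 0"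
  proof (rule Lim_null_comparison)
    \<comment> \<open>The initial segment removed from \<open>G\<close> has fixed length, so its
      proportion vanishes.\<close>
    have "(\<lambda>s. real Nmax / real (N s)) \<longlonglongrightarrow> 0"
      using Ninf by (intro tendsto_divide_0[OF tendsto_const] filterlim_at_top_imp_at_infinity
        filterlim_compose[OF filterlim_real_sequentially])
    from tendsto_add[OF this \<kappa>0]
    show "(\<lambda>s. real Nmax / real (N s) + 1 / real (\<kappa> s)) \<longlonglongrightarrow> 0" by simp
    have "\<forall>\<^sub>F s in sequentially. \<kappa> s \<ge> 1" using \<kappa> by (simp add: filterlim_at_top)
    then show "\<forall>\<^sub>F s in sequentially. norm (real (card (block s - G)) / real (N s))
        \<le> real Nmax / real (N s) + 1 / real (\<kappa> s)"
      using eventually_ge_at_top[of 1]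
    proof eventually_elim
      case (elim s)
      have "block s - G \<subseteq> {1..Nmax} \<union> {n \<in> {1..N s}. \<nexists>Q. admissible_modulus A (\<kappa> s) (H s) n Q}"
        using elim by (auto simp: G_def block_def)
      then have "card (block s - G) \<le> card ({1..Nmax} \<union> {n \<in> {1..N s}. \<nexists>Q. admissible_modulus A (\<kappa> s) (H s) n Q})"
        by (intro card_mono) auto
      also have "\<dots> \<le> card {1..Nmax} + card {n \<in> {1..N s}. \<nexists>Q. admissible_modulus A (\<kappa> s) (H s) n Q}"
        by (rule card_Un_le)
      finally have "real (card (block s - G)) \<le> real Nmax + real (N s) / real (\<kappa> s)"
        using few[OF elim(1)] by simp
      then have "real (card (block s - G)) / real (N s) \<le> (real Nmax + real (N s) / real (\<kappa> s)) / real (N s)"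
        by (intro divide_right_mono) auto
      also have "\<dots> = real Nmax / real (N s) + 1 / real (\<kappa> s)"
        using Npos[OF elim(2)] by (simp add: add_divide_distrib)
      finally show ?case by simp
    qed
  qed
  moreover have "filterlim (\<lambda>n. least_nondivisor (Q n)) at_top (inf sequentially (principal G))"
    unfolding filterlim_at_top eventually_inf_principal
  proof
    fix Z
    obtain s2 where s2: "\<And>s. s \<ge> s2 \<Longrightarrow> Z \<le> \<kappa> s"
      using \<kappa> unfolding filterlim_at_top eventually_sequentially by blast
    \<comment> \<open>An \<open>n\<close> beyond all \<open>N s\<close> with
      \<open>s \<le> s2\<close> lies only in later blocks, where
      \<open>\<kappa> s \<ge> Z\<close>.\<close>
    show "\<forall>\<^sub>F n in sequentially. n \<in> G \<longrightarrow> Z \<le> least_nondivisor (Q n)"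
      using eventually_gt_at_top[of "Max (N ` {..s2})"]
    proof eventually_elim
      case (elim n)
      show ?case
      proof
        assume nG: "n \<in> G"
        then obtain s where s: "n \<in> block s" "n > Nmax" by (auto simp: G_def)
        have "s \<ge> s2"
        proof (rule ccontr)
          assume "\<not> s \<ge> s2"
          then have "N s \<le> Max (N ` {..s2})" by (intro Max_ge) auto
          then show False using s elim by (simp add: block_def)
        qed
        then have "Z \<le> \<kappa> s" by (rule s2)
        moreover have adm: "fact (\<kappa> s) dvd Q n" "H s \<le> Q n"
          using Q[OF nG s(1)] by (auto simp: admissible_modulus_def)
        moreover have "Q n \<ge> 1" using adm(2) Hpos[of s] late[OF s] by simp
        ultimately show "Z \<le> least_nondivisor (Q n)" using less_least_nondivisor[of "\<kappa> s" "Q n"] by simp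
      qed
    qed
  qed
  moreover have "\<forall>s\<ge>1. \<forall>n \<in> block s \<inter> G.
       real (H s) \<le> real (Q n) \<and> real (Q n) \<le> (1 + 1 / real (\<kappa> s)) * real (H s) \<and>
       (\<forall>B \<subseteq> {1..H s}.
          real (card (popular_sumset (1 / real (\<kappa> s)) (Q n) (shift A n \<inter> {0..<int (Q n)}) (int ` B)
                      - shift (A + B) n \<inter> {0..<int (Q n)}))
          \<le> 1 / real (\<kappa> s) * real (Q n))"
  proof (intro allI impI ballI)
    fix s n assume "n \<in> block s \<inter> G"
    then have "admissible_modulus A (\<kappa> s) (H s) n (Q n)" using Q by blast
    then show "real (H s) \<le> real (Q n) \<and> real (Q n) \<le> (1 + 1 / real (\<kappa> s)) * real (H s) \<and>
       (\<forall>B \<subseteq> {1..H s}.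
          real (card (popular_sumset (1 / real (\<kappa> s)) (Q n) (shift A n \<inter> {0..<int (Q n)}) (int ` B)
                      - shift (A + B) n \<inter> {0..<int (Q n)}))
          \<le> 1 / real (\<kappa> s) * real (Q n))"
      unfolding admissible_modulus_def by (elim conjE, intro conjI; (assumption | simp only: of_nat_le_iff))
  qed
  ultimately show ?thesis using \<kappa>0 unfolding block_def by blast
qed

end
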